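(* Let $1<p\leq 2$. There is a constant $C_p>0$ depending only on $p$ such that the following holds. Let $\{\sigma(l)\}_{l\in\frac12\mathbb{N}_0}$ be a sequence of complex matrices $\sigma(l)\in\mathbb{C}^{(2l+1)\times(2l+1)}$ such that $$K_\sigma:=\sup_{s>0}\ s\sum_{\substack{l\in\frac12\mathbb{N}_0\\ \|\sigma(l)\|_{\mathrm{op}}\geq s}}(2l+1)^2<\infty.$$ Then for every $f\in L^p(\mathrm{SU}(2))$, $$\sum_{l\in\frac12\mathbb{N}_0}(2l+1)^{p\left(\frac2p-\frac12\right)}\,\|\widehat f(l)\|_{\mathrm{HS}}^p\,\|\sigma(l)\|_{\mathrm{op}}^{2-p}\leq C_p\,K_\sigma^{2-p}\,\|f\|^p_{L^p(\mathrm{SU}(2))}.$$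
   Context: $\mathrm{SU}(2)$ carries the normalized Haar measure $du$, and $\frac12\mathbb{N}_0=\{0,\frac12,1,\frac32,\dots\}$. For $l\in\frac12\mathbb{N}_0$, let $V_l$ be the $(2l+1)$-dimensional space of homogeneous polynomials of degree $2l$ in two complex variables $z=(z_1,z_2)$ (a row vector), and let $t^l$ be the irreducible representation $(t^l(u)P)(z)=P(zu)$ of $\mathrm{SU}(2)$ on $V_l$, written in a basis of $V_l$ making it a unitary matrix representation $t^l:\mathrm{SU}(2)\to \mathrm{U}(2l+1)$. Every irreducible unitary representation of $\mathrm{SU}(2)$ is equivalent to exactly one $t^l$. The Fourier coefficient of $f\in L^1(\mathrm{SU}(2))$ is the matrix $\widehat f(l)=\int_{\mathrm{SU}(2)}f(u)\,t^l(u)^*\,du\in\mathbb{C}^{(2l+1)\times(2l+1)}$. $\|M\|_{\mathrm{HS}}=(\operatorname{Tr}MM^* )^{1/2}$ is the Hilbert–Schmidt norm and $\|M\|_{\mathrm{op}}$ is the operator norm on $\ell^2$. A power with exponent $0$ is read as $1$ (including $0^0=1$). *)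

theory Defs
  imports
    "HOL-Probability.Probability"
    "Jordan_Normal_Form.Schur_Decomposition"
begin

(* Half-integers l are indexed by the natural number n = 2 * l throughout, so that
   2 * l + 1 = n + 1.  Elements of SU(2) have the fixed-size type complex^2^2; the matrices
   of varying size n + 1 are Jordan_Normal_Form matrices. *)

definition SU2 :: "(complex^2^2) set" where
  "SU2 = {u. u ** transpose (map_matrix cnj u) = Finite_Cartesian_Product.mat 1
             \<and> Determinants.det u = 1}"

(* Regularity is automatic: SU2 is compact and metrizable and the measure is finite. *)
definition normalized_haar_SU2 :: "(complex^2^2) measure \<Rightarrow> bool" where
  "normalized_haar_SU2 \<mu> \<longleftrightarrow>
     prob_space \<mu> \<and>
     space \<mu> = SU2 \<and>
     sets \<mu> = sets (restrict_space borel SU2) \<and>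
     (\<forall>g\<in>SU2. distr \<mu> \<mu> (\<lambda>u. g ** u) = \<mu>)"

(* V_l for n = 2 * l, with polynomials identified with the functions they induce on C^2. *)
definition hom_polys :: "nat \<Rightarrow> (complex^2 \<Rightarrow> complex) set" where
  "hom_polys n =
     {P. \<exists>c :: nat \<Rightarrow> complex.
           P = (\<lambda>z. \<Sum>k\<le>n. c k * vec_nth z 1 ^ k * vec_nth z 2 ^ (n - k))}"

definition SU2_act :: "complex^2^2 \<Rightarrow> (complex^2 \<Rightarrow> complex) \<Rightarrow> (complex^2 \<Rightarrow> complex)" where
  "SU2_act u P = (\<lambda>z. P (z v* u))"

definition lin_comb :: "nat \<Rightarrow> (nat \<Rightarrow> complex^2 \<Rightarrow> complex) \<Rightarrow> (nat \<Rightarrow> complex) \<Rightarrow>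
    (complex^2 \<Rightarrow> complex)" where
  "lin_comb n b c = (\<lambda>z. \<Sum>i\<le>n. c i * b i z)"

(* b 0, ..., b n is a basis of hom_polys n; the values of b beyond n play no role. *)
definition hom_polys_basis :: "nat \<Rightarrow> (nat \<Rightarrow> complex^2 \<Rightarrow> complex) \<Rightarrow> bool" where
  "hom_polys_basis n b \<longleftrightarrow>
     (\<forall>i\<le>n. b i \<in> hom_polys n) \<and>
     (\<forall>c. lin_comb n b c = (\<lambda>z. 0) \<longrightarrow> (\<forall>i\<le>n. c i = 0)) \<and>
     (\<forall>P\<in>hom_polys n. \<exists>c. P = lin_comb n b c)"

(* T is the representation t^l (n = 2 * l) written in some basis of V_l in which it is
   unitary.  Column j of T u holds the coordinates of the image of the j-th basis vector. *)
definition SU2_unitary_rep :: "nat \<Rightarrow> (complex^2^2 \<Rightarrow> complex mat) \<Rightarrow> bool" where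
  "SU2_unitary_rep n T \<longleftrightarrow>
     (\<exists>b. hom_polys_basis n b \<and>
       (\<forall>u\<in>SU2.
          T u \<in> carrier_mat (n + 1) (n + 1) \<and>
          (\<forall>j\<le>n. SU2_act u (b j) = lin_comb n b (\<lambda>i. T u $$ (i, j))) \<and>
          T u * mat_adjoint (T u) = 1\<^sub>m (n + 1)))"

definition fourier_coeff ::
  "(complex^2^2) measure \<Rightarrow> (nat \<Rightarrow> complex^2^2 \<Rightarrow> complex mat) \<Rightarrow> (complex^2^2 \<Rightarrow> complex) \<Rightarrow>
    nat \<Rightarrow> complex mat" where
  "fourier_coeff \<mu> t f n =
     Matrix.mat (n + 1) (n + 1)
       (\<lambda>(i, j). LINT u|\<mu>. f u * mat_adjoint (t n u) $$ (i, j))"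

definition mat_trace :: "complex mat \<Rightarrow> complex" where
  "mat_trace M = (\<Sum>i<dim_row M. M $$ (i, i))"

definition hs_norm :: "complex mat \<Rightarrow> real" where
  "hs_norm M = sqrt (Re (mat_trace (M * mat_adjoint M)))"

definition l2_norm :: "complex Matrix.vec \<Rightarrow> real" where
  "l2_norm v = sqrt (\<Sum>i<dim_vec v. (cmod (vec_index v i))\<^sup>2)"

definition op_norm :: "complex mat \<Rightarrow> real" where
  "op_norm M =
     (SUP v \<in> {v \<in> carrier_vec (dim_col M). l2_norm v \<le> 1}. l2_norm (M *\<^sub>v v))"

definition in_Lp :: "(complex^2^2) measure \<Rightarrow> real \<Rightarrow> (complex^2^2 \<Rightarrow> complex) \<Rightarrow> bool" where
  "in_Lp \<mu> p f \<longleftrightarrow> f \<in> borel_measurable \<mu> \<and> integrable \<mu> (\<lambda>u. cmod (f u) powr p)"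

definition Lp_norm :: "(complex^2^2) measure \<Rightarrow> real \<Rightarrow> (complex^2^2 \<Rightarrow> complex) \<Rightarrow> real" where
  "Lp_norm \<mu> p f = (LINT u|\<mu>. cmod (f u) powr p) powr (1 / p)"

definition K_const :: "(nat \<Rightarrow> complex mat) \<Rightarrow> ennreal" where
  "K_const \<sigma> =
     (SUP s \<in> {0 :: real <..}.
        ennreal s * (\<Sum>\<^sub>\<infinity>n \<in> {n. op_norm (\<sigma> n) \<ge> s}. ennreal (real (n + 1) ^ 2)))"

(* Unlike powr, which has 0 powr 0 = 0, this has value 1 whenever the exponent is 0. *)
definition pow0 :: "real \<Rightarrow> real \<Rightarrow> real" where
  "pow0 x a = (if a = 0 then 1 else x powr a)"

end

theory Submission
  imports Defs
begin

text \<open>Give the index \<open>n = 2 l\<close> the mass \<open>(n + 1)\<^sup>2 \<tau>\<^sub>n\<^sup>2\<close>, where \<open>\<tau>\<^sub>n\<close> is the operator norm of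
  \<open>\<sigma> n\<close>, and send \<open>f\<close> to the sequence \<open>G\<^sub>n = \<parallel>f^(n)\<parallel>\<^sub>H\<^sub>S / (\<surd>(n + 1) \<tau>\<^sub>n)\<close>.  The left-hand side is the
  \<open>p\<close>-th power of the weighted \<open>l\<^sup>p\<close> norm of \<open>G\<close>.  Bessel's inequality for the matrix coefficients
  (Schur orthogonality) is the \<open>L\<^sup>2\<close> bound with constant 1.  Since \<open>\<tau>\<^sub>n G\<^sub>n \<le> \<parallel>f\<parallel>\<^sub>1\<close>, the level set
  \<open>{G\<^sub>n > y}\<close> only contains indices with \<open>\<tau>\<^sub>n < \<parallel>f\<parallel>\<^sub>1 / y\<close>, whose mass is at most \<open>2 K \<parallel>f\<parallel>\<^sub>1 / y\<close> by the
  layer-cake formula: the map is of weak type (1,1) with constant \<open>2 K\<close>.  Marcinkiewicz interpolation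
  gives the case \<open>p < 2\<close>, and \<open>p = 2\<close> is Bessel's inequality itself.\<close>

section \<open>Interpolation\<close>

text \<open>For p < 2 a function in L^p need not lie in L^2, so it is split anew at every level; as
  the Haar measure has total mass 1, both pieces stay integrable and have Fourier coefficients. The
  two half-line integrals that remain at each point converge at infinity because p < 2 and at 0
  because p > 1; they produce the summands 4p/(2-p) and 4p/(p-1) of the constant. The first blows up
  as p tends to 2, hence the separate endpoint. The obstacle on the group side is that each t^l is
  given only as a unitary matrix in some unknown basis: Schur's lemma and continuity of the entries
  are obtained in monomial coordinates and then transported to that basis. All estimates are made
  for finite sets of indices with constants independent of the set, so that the weighted l^p norm is
  a plain finite sum.\<close>

lemma nn_integral_powr_from_0:
  assumes "a > -1" "0 \<le> c"
  shows "(\<integral>\<^sup>+y. ennreal (y powr a) * indicator {0<..<c} y \<partial>lborel)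
    = ennreal (c powr (a + 1) / (a + 1))"
proof -
  have ae: "AE y in lborel. y \<noteq> 0 \<and> y \<noteq> c"
    using AE_lborel_singleton[of "0::real"] AE_lborel_singleton[of c] by eventually_elim auto
  then have "(\<integral>\<^sup>+y. ennreal (y powr a) * indicator {0<..<c} y \<partial>lborel)
    = (\<integral>\<^sup>+y. ennreal (y powr a) * indicator {0..c} y \<partial>lborel)"
    by (intro nn_integral_cong_AE eventually_mono[OF ae]) (auto split: split_indicator)
  also have "\<dots> = ennreal (c powr (a + 1) / (a + 1))"
    by (rule nn_integral_has_integral_lebesgue'[OF _ has_integral_powr_from_0[OF assms]]) auto
  finally show ?thesis .
qed

lemma nn_integral_powr_to_inf:
  assumes "a < -1" "0 < c"
  shows "(\<integral>\<^sup>+y. ennreal (y powr a) * indicator {c..} y \<partial>lborel)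
    = ennreal (c powr (a + 1) / - (a + 1))"
proof -
  have "(\<integral>\<^sup>+y. ennreal (y powr a) * indicator {c..} y \<partial>lborel)
      = ennreal (- (c powr (a + 1)) / (a + 1))"
    by (rule nn_integral_has_integral_lebesgue'[OF _ has_integral_powr_to_inf[OF assms]]) auto
  also have "- (c powr (a + 1)) / (a + 1) = c powr (a + 1) / - (a + 1)"
    by (metis minus_divide_left minus_divide_right)
  finally show ?thesis .
qed

text \<open>Layer-cake formula for finitely many point masses \<open>c i\<close>: each
  \<open>x i powr p\<close> is the integral of \<open>p * y powr (p - 1)\<close> over 0 < y <
  \<open>x i\<close>, and the finite sum moves inside.\<close>

lemma sum_nn_integral_layers:
  fixes c x :: "'i \<Rightarrow> real"
  assumes "0 < p" and c: "\<And>i. i \<in> S \<Longrightarrow> 0 \<le> c i" and x: "\<And>i. i \<in> S \<Longrightarrow> 0 \<le> x i"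
  shows "ennreal (\<Sum>i\<in>S. c i * x i powr p)
    = (\<integral>\<^sup>+y. ennreal (p * y powr (p - 1)) * ennreal (\<Sum>i\<in>S. c i * indicator {0<..<x i} y) \<partial>lborel)"
proof -
  have "ennreal (c i * x i powr p)
      = (\<integral>\<^sup>+y. ennreal (c i * p) * (ennreal (y powr (p - 1)) * indicator {0<..<x i} y) \<partial>lborel)"
    if "i \<in> S" for i
    using nn_integral_powr_from_0[of "p - 1" "x i"] c[OF that] x[OF that] \<open>0 < p\<close>
    by (subst nn_integral_cmult) (auto simp: ennreal_mult'[symmetric])
  then have "ennreal (\<Sum>i\<in>S. c i * x i powr p)
      = (\<Sum>i\<in>S. (\<integral>\<^sup>+y. ennreal (c i * p) * (ennreal (y powr (p - 1)) * indicator {0<..<x i} y) \<partial>lborel))"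
    using c by (subst sum_ennreal[symmetric]) auto
  also have "\<dots> = (\<integral>\<^sup>+y. (\<Sum>i\<in>S. ennreal (c i * p) * (ennreal (y powr (p - 1)) * indicator {0<..<x i} y)) \<partial>lborel)"
    by (rule nn_integral_sum[symmetric]) auto
  also have "\<dots> = (\<integral>\<^sup>+y. ennreal (p * y powr (p - 1)) * ennreal (\<Sum>i\<in>S. c i * indicator {0<..<x i} y) \<partial>lborel)"
  proof (intro nn_integral_cong)
    fix y :: real
    have "(\<Sum>i\<in>S. ennreal (c i * p) * (ennreal (y powr (p - 1)) * indicator {0<..<x i} y))
        = (\<Sum>i\<in>S. ennreal (p * y powr (p - 1)) * ennreal (c i * indicator {0<..<x i} y))"
      using c \<open>0 < p\<close>
      by (intro sum.cong refl) (auto simp: ennreal_mult'[symmetric] mult_ac split: split_indicator)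
    also have "\<dots> = ennreal (p * y powr (p - 1)) * ennreal (\<Sum>i\<in>S. c i * indicator {0<..<x i} y)"
      using c by (simp add: sum_distrib_left[symmetric] sum_ennreal)
    finally show "(\<Sum>i\<in>S. ennreal (c i * p) * (ennreal (y powr (p - 1)) * indicator {0<..<x i} y))
      = ennreal (p * y powr (p - 1)) * ennreal (\<Sum>i\<in>S. c i * indicator {0<..<x i} y)" .
  qed
  finally show ?thesis .
qed

text \<open>Since d(y^2) = 2 y dy, the layer at height \<open>y\<close> contributes 2 y times a mass
  of at most \<open>K / y\<close>, that is \<open>2 * K\<close>. Restricting to
  \<open>\<tau> i \<le> v\<close> empties all layers above \<open>v\<close>, so only an interval of
  length \<open>v\<close> is integrated.\<close>

lemma sum_squares_le_of_level_bound:
  fixes w \<tau> :: "'i \<Rightarrow> real"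
  assumes S: "finite S" and w: "\<And>i. i \<in> S \<Longrightarrow> 0 \<le> w i" and \<tau>: "\<And>i. i \<in> S \<Longrightarrow> 0 \<le> \<tau> i"
    and K: "0 \<le> K" "\<And>s. 0 < s \<Longrightarrow> s * (\<Sum>i\<in>{i \<in> S. s \<le> \<tau> i}. w i) \<le> K"
    and v: "0 \<le> v"
  shows "(\<Sum>i\<in>{i \<in> S. \<tau> i \<le> v}. w i * (\<tau> i)\<^sup>2) \<le> 2 * K * v"
proof -
  let ?S = "{i \<in> S. \<tau> i \<le> v}"
  have pw: "(\<tau> i)\<^sup>2 = \<tau> i powr 2" if "i \<in> S" for i
    using \<tau>[OF that] by (cases "\<tau> i = 0") (auto simp: powr_numeral)
  have "ennreal (\<Sum>i\<in>?S. w i * (\<tau> i)\<^sup>2) = ennreal (\<Sum>i\<in>?S. w i * \<tau> i powr 2)"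
    by (intro arg_cong[where f=ennreal] sum.cong) (auto simp: pw)
  also have "\<dots> = (\<integral>\<^sup>+y. ennreal (2 * y powr (2 - 1)) * ennreal (\<Sum>i\<in>?S. w i * indicator {0<..<\<tau> i} y) \<partial>lborel)"
    using w \<tau> by (intro sum_nn_integral_layers) auto
  also have "\<dots> \<le> (\<integral>\<^sup>+y. ennreal (2 * K) * indicator {0..v} y \<partial>lborel)"
  proof (intro nn_integral_mono)
    fix y :: real
    show "ennreal (2 * y powr (2 - 1)) * ennreal (\<Sum>i\<in>?S. w i * indicator {0<..<\<tau> i} y)
      \<le> ennreal (2 * K) * indicator {0..v} y"
    proof (cases "0 < y \<and> y \<le> v")
      case True
      have "(\<Sum>i\<in>?S. w i * indicator {0<..<\<tau> i} y) \<le> (\<Sum>i\<in>?S. if y \<le> \<tau> i then w i else 0)"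
        using w by (intro sum_mono) (auto split: split_indicator)
      also have "\<dots> \<le> (\<Sum>i\<in>S. if y \<le> \<tau> i then w i else 0)"
        using S w by (intro sum_mono2) auto
      also have "\<dots> = (\<Sum>i\<in>{i \<in> S. y \<le> \<tau> i}. w i)"
        using S by (simp add: sum.inter_filter)
      finally have "y * (\<Sum>i\<in>?S. w i * indicator {0<..<\<tau> i} y) \<le> y * (\<Sum>i\<in>{i \<in> S. y \<le> \<tau> i}. w i)"
        using True by (intro mult_left_mono) auto
      also have "\<dots> \<le> K"
        using K True by auto
      finally show ?thesis
        using True K by (auto simp: ennreal_mult'[symmetric])
    next
      case False
      then have "(\<Sum>i\<in>?S. w i * indicator {0<..<\<tau> i} y) = 0"
        by (intro sum.neutral) (auto split: split_indicator)
      then show ?thesis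
        by simp
    qed
  qed
  also have "\<dots> = ennreal (2 * K * v)"
    using v K by (simp add: nn_integral_cmult_indicator ennreal_mult'[symmetric])
  finally show ?thesis
    using v K by (simp add: ennreal_le_iff)
qed

text \<open>Here \<open>a\<close> stands for \<open>cmod (f u)\<close> at a fixed point, which
  belongs to the low part exactly at the levels \<open>y \<ge> a / K\<close>. The integrand is a
  multiple of \<open>y powr (p - 3)\<close>, integrable at infinity since p < 2.\<close>

lemma nn_integral_low_layers:
  assumes p: "1 < p" "p < 2" and K: "0 < K" and a: "0 \<le> a"
  shows "(\<integral>\<^sup>+y. ennreal (p * y powr (p - 1)) * ennreal (4 / y\<^sup>2 * a\<^sup>2) * indicator {y. 0 < y \<and> a \<le> K * y} y \<partial>lborel)
    = ennreal (4 * p / (2 - p) * K powr (2 - p) * a powr p)"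
proof (cases "a = 0")
  case True
  then show ?thesis
    by simp
next
  case False
  have "(\<integral>\<^sup>+y. ennreal (p * y powr (p - 1)) * ennreal (4 / y\<^sup>2 * a\<^sup>2) * indicator {y. 0 < y \<and> a \<le> K * y} y \<partial>lborel)
     = (\<integral>\<^sup>+y. ennreal (4 * p * a\<^sup>2) * (ennreal (y powr (p - 3)) * indicator {a / K..} y) \<partial>lborel)"
  proof (intro nn_integral_cong)
    fix y :: real
    show "ennreal (p * y powr (p - 1)) * ennreal (4 / y\<^sup>2 * a\<^sup>2) * indicator {y. 0 < y \<and> a \<le> K * y} y
      = ennreal (4 * p * a\<^sup>2) * (ennreal (y powr (p - 3)) * indicator {a / K..} y)"
    proof (cases "a / K \<le> y")
      case True
      then have y: "0 < y" "a \<le> K * y"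
        using False a K by (auto simp: field_simps intro: less_le_trans[of 0 "a / K"])
      have "y powr (p - 3) * y\<^sup>2 = y powr (p - 1)"
        using y by (simp add: powr_numeral[symmetric] powr_add[symmetric] del: powr_numeral)
      then have "p * y powr (p - 1) * (4 / y\<^sup>2 * a\<^sup>2) = 4 * p * a\<^sup>2 * y powr (p - 3)"
        using y by (simp add: field_simps)
      then show ?thesis
        using True y p by (simp add: ennreal_mult'[symmetric])
    next
      case nle: False
      then show ?thesis
        using K by (auto simp: field_simps split: split_indicator)
    qed
  qed
  also have "\<dots> = ennreal (4 * p * a\<^sup>2) * ennreal ((a / K) powr (p - 3 + 1) / - (p - 3 + 1))"
    using p K a False by (subst nn_integral_cmult) (auto simp: nn_integral_powr_to_inf)
  also have "\<dots> = ennreal (4 * p / (2 - p) * K powr (2 - p) * a powr p)"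
  proof -
    have "(a / K) powr (p - 2) = a powr (p - 2) * K powr (2 - p)"
      using a K by (simp add: powr_divide powr_minus_divide[of K "p - 2", symmetric] powr_diff field_simps)
    moreover have "a powr (p - 2) * a\<^sup>2 = a powr p"
      using a False by (simp add: powr_numeral[symmetric] powr_add[symmetric] del: powr_numeral)
    ultimately have "4 * p * a\<^sup>2 * ((a / K) powr (p - 2) / (2 - p)) = 4 * p / (2 - p) * K powr (2 - p) * a powr p"
      by (simp add: field_simps)
    then show ?thesis
      using p by (simp add: ennreal_mult'[symmetric])
  qed
  finally show ?thesis .
qed

text \<open>On the complementary levels the integrand is a multiple of
  \<open>y powr (p - 2)\<close>, integrable at 0 since p > 1. The weak-type factor \<open>K\<close>
  combines with (a/K)^(p-1) to the same power \<open>K powr (2 - p)\<close> as in the low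
  part.\<close>

lemma nn_integral_high_layers:
  assumes p: "1 < p" "p < 2" and K: "0 < K" and a: "0 \<le> a"
  shows "(\<integral>\<^sup>+y. ennreal (p * y powr (p - 1)) * ennreal (4 * K / y * a) * indicator {y. 0 < y \<and> K * y < a} y \<partial>lborel)
    = ennreal (4 * p / (p - 1) * K powr (2 - p) * a powr p)"
proof (cases "a = 0")
  case True
  then show ?thesis
    by simp
next
  case False
  have "(\<integral>\<^sup>+y. ennreal (p * y powr (p - 1)) * ennreal (4 * K / y * a) * indicator {y. 0 < y \<and> K * y < a} y \<partial>lborel)
     = (\<integral>\<^sup>+y. ennreal (4 * p * K * a) * (ennreal (y powr (p - 2)) * indicator {0<..<a / K} y) \<partial>lborel)"
  proof (intro nn_integral_cong)
    fix y :: real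
    show "ennreal (p * y powr (p - 1)) * ennreal (4 * K / y * a) * indicator {y. 0 < y \<and> K * y < a} y
      = ennreal (4 * p * K * a) * (ennreal (y powr (p - 2)) * indicator {0<..<a / K} y)"
    proof (cases "0 < y \<and> y < a / K")
      case True
      then have y: "0 < y" "K * y < a"
        using K by (auto simp: field_simps)
      have "y powr (p - 2) * y = y powr (p - 1)"
        using y powr_mult_base[of y "p - 2"] by (simp add: mult.commute)
      then have "p * y powr (p - 1) * (4 * K / y * a) = 4 * p * K * a * y powr (p - 2)"
        using y by (simp add: field_simps)
      then show ?thesis
        using True y p K a by (simp add: ennreal_mult'[symmetric])
    next
      case nle: False
      then show ?thesis
        using K by (auto simp: field_simps split: split_indicator)
    qed
  qed
  also have "\<dots> = ennreal (4 * p * K * a) * ennreal ((a / K) powr (p - 2 + 1) / (p - 2 + 1))"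
    using p K a False by (subst nn_integral_cmult) (auto simp: nn_integral_powr_from_0)
  also have "\<dots> = ennreal (4 * p / (p - 1) * K powr (2 - p) * a powr p)"
  proof -
    have "K * (a / K) powr (p - 1) = a powr (p - 1) * K powr (2 - p)"
      using a K by (simp add: powr_divide powr_diff field_simps power2_eq_square)
    then have "4 * p * K * a * ((a / K) powr (p - 1) / (p - 1))
        = 4 * p / (p - 1) * K powr (2 - p) * (a powr (p - 1) * a)"
      by (simp add: mult_ac)
    also have "a powr (p - 1) * a = a powr p"
      using a powr_mult_base[of a "p - 1"] by (simp add: mult.commute)
    finally show ?thesis
      using p K a by (simp add: ennreal_mult'[symmetric])
  qed
  finally show ?thesis .
qed

text \<open>At level \<open>y\<close> the function is truncated at height \<open>K * y\<close>; this makes the \<open>L\<^sup>2\<close> contribution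
  of the low part and the weak \<open>L\<^sup>1\<close> contribution of the high part of the same order.\<close>

lemma marcinkiewicz_weighted_sum:
  fixes M :: "'a measure" and F :: "('a \<Rightarrow> complex) \<Rightarrow> 'i \<Rightarrow> real" and w \<tau> :: "'i \<Rightarrow> real"
  assumes "prob_space M" and p: "1 < p" "p < 2" and S: "finite S"
    and w: "\<And>n. n \<in> S \<Longrightarrow> 0 \<le> w n" and \<tau>: "\<And>n. n \<in> S \<Longrightarrow> 0 \<le> \<tau> n"
    and K: "0 < K" "\<And>s. 0 < s \<Longrightarrow> s * (\<Sum>n\<in>{n \<in> S. s \<le> \<tau> n}. w n) \<le> K"
    and nonneg: "\<And>g n. 0 \<le> F g n"
    and L2: "\<And>g B. g \<in> borel_measurable M \<Longrightarrow> (\<And>u. cmod (g u) \<le> B) \<Longrightarrow>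
      (\<Sum>n\<in>S. w n * (F g n)\<^sup>2) \<le> (\<integral>u. (cmod (g u))\<^sup>2 \<partial>M)"
    and L1: "\<And>h n. integrable M h \<Longrightarrow> n \<in> S \<Longrightarrow> F h n \<le> (\<integral>u. cmod (h u) \<partial>M)"
    and add: "\<And>g h n. integrable M g \<Longrightarrow> integrable M h \<Longrightarrow> n \<in> S \<Longrightarrow>
      F (\<lambda>u. g u + h u) n \<le> F g n + F h n"
    and f [measurable]: "f \<in> borel_measurable M" and fp: "integrable M (\<lambda>u. cmod (f u) powr p)"
  shows "(\<Sum>n\<in>S. w n * F f n powr p * \<tau> n powr (2 - p))
    \<le> (4 * p / (2 - p) + 4 * p / (p - 1)) * K powr (2 - p) * (\<integral>u. cmod (f u) powr p \<partial>M)"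
proof -
  interpret prob_space M by fact
  interpret P: pair_sigma_finite lborel M ..
  \<comment> \<open>On a probability space this domination puts \<open>f\<close> into L^1, so that
    \<open>L1\<close> and \<open>add\<close> apply to its pieces.\<close>
  have f_le: "norm (f u) \<le> norm (1 + cmod (f u) powr p)" for u
  proof (cases "cmod (f u) \<le> 1")
    case False
    then have "cmod (f u) powr 1 \<le> cmod (f u) powr p"
      using p by (intro powr_mono) auto
    then show ?thesis
      using False by simp
  qed (simp add: add_increasing2)
  have intf: "integrable M f"
    by (rule Bochner_Integration.integrable_bound[OF Bochner_Integration.integrable_add[OF integrable_const fp] f AE_I2[OF f_le]])
  define g h where "g y u = (if cmod (f u) \<le> K * y then f u else 0)"
    and "h y u = (if cmod (f u) \<le> K * y then 0 else f u)" for y u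
  \<comment> \<open>The factor 4 / y^2 is Chebyshev's for the low part at half height; 4 K / y comes
    from \<open>2 * K * v\<close> with the threshold \<open>v\<close> below.\<close>
  define H where "H y u = (if 0 < y then ennreal (p * y powr (p - 1)) *
    ennreal (4 / y\<^sup>2 * (cmod (g y u))\<^sup>2 + 4 * K / y * cmod (h y u)) else 0)" for y u
  define \<nu> where "\<nu> n = w n * (\<tau> n)\<^sup>2" for n
  \<comment> \<open>Division by zero gives \<open>G n = 0\<close> where \<open>\<tau> n = 0\<close>,
    so such an index lies in no level set.\<close>
  define G where "G n = F f n / \<tau> n" for n
  have [measurable]: "g y \<in> borel_measurable M" "h y \<in> borel_measurable M" for y
    unfolding g_def h_def by measurable
  have gb: "cmod (g y u) \<le> \<bar>K * y\<bar>" for y u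
    by (auto simp: g_def)
  have int_g: "integrable M (g y)" for y
    by (rule integrable_const_bound[OF AE_I2[OF gb]]) simp
  have int_g2: "integrable M (\<lambda>u. (cmod (g y u))\<^sup>2)" for y
    using power_mono[OF gb[of y] norm_ge_zero, of _ 2]
    by (intro integrable_const_bound[of _ "\<bar>K * y\<bar>\<^sup>2"]) auto
  have int_h: "integrable M (h y)" for y
    by (rule Bochner_Integration.integrable_bound[OF intf]) (auto simp: h_def)
  have f_split: "f = (\<lambda>u. g y u + h y u)" for y
    by (auto simp: g_def h_def)
  have pointwise: "(\<Sum>n\<in>S. \<nu> n * indicator {0<..<G n} y)
      \<le> (\<integral>u. 4 / y\<^sup>2 * (cmod (g y u))\<^sup>2 + 4 * K / y * cmod (h y u) \<partial>M)" if y: "0 < y" for y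
  proof -
    \<comment> \<open>Chosen so that \<open>\<tau> n > v\<close> forces the high part below
      \<open>y * \<tau> n / 2\<close>; on the level set the low part then carries at least the other
      half. Indices with \<open>\<tau> n \<le> v\<close> are charged with their full mass.\<close>
    define v where "v = 2 * (\<integral>u. cmod (h y u) \<partial>M) / y"
    have "\<nu> n * indicator {0<..<G n} y \<le> 4 / y\<^sup>2 * (w n * (F (g y) n)\<^sup>2) + (if \<tau> n \<le> v then \<nu> n else 0)"
      if n: "n \<in> S" for n
    proof (cases "y < G n \<and> \<not> \<tau> n \<le> v")
      case True
      then have "0 < \<tau> n"
        using \<tau>[OF n] y by (cases "\<tau> n = 0") (auto simp: G_def)
      have "y * \<tau> n < F f n"
        using True \<open>0 < \<tau> n\<close> by (simp add: G_def field_simps)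
      also have "F f n \<le> F (g y) n + F (h y) n"
        using add[OF int_g int_h n, of y y] f_split[of y] by simp
      also have "F (h y) n \<le> v * y / 2"
        using L1[OF int_h n] y by (simp add: v_def)
      also have "v * y / 2 \<le> \<tau> n * y / 2"
        using True y by simp
      finally have "y * \<tau> n \<le> 2 * F (g y) n"
        by (simp add: mult.commute)
      then have "(y * \<tau> n)\<^sup>2 \<le> (2 * F (g y) n)\<^sup>2"
        using y \<open>0 < \<tau> n\<close> by (intro power_mono) auto
      then have "(\<tau> n)\<^sup>2 \<le> 4 / y\<^sup>2 * (F (g y) n)\<^sup>2"
        using y by (simp add: field_simps power_mult_distrib)
      then have "w n * (\<tau> n)\<^sup>2 \<le> w n * (4 / y\<^sup>2 * (F (g y) n)\<^sup>2)"
        using w[OF n] by (intro mult_left_mono) auto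
      then show ?thesis
        using True y by (simp add: \<nu>_def mult_ac)
    next
      case False
      then show ?thesis
        using w[OF n] by (auto simp: \<nu>_def split: split_indicator)
    qed
    then have "(\<Sum>n\<in>S. \<nu> n * indicator {0<..<G n} y)
      \<le> (\<Sum>n\<in>S. 4 / y\<^sup>2 * (w n * (F (g y) n)\<^sup>2) + (if \<tau> n \<le> v then \<nu> n else 0))"
      by (rule sum_mono)
    also have "\<dots> = 4 / y\<^sup>2 * (\<Sum>n\<in>S. w n * (F (g y) n)\<^sup>2) + (\<Sum>n\<in>{n \<in> S. \<tau> n \<le> v}. w n * (\<tau> n)\<^sup>2)"
      using S by (simp add: sum.distrib sum_distrib_left sum.inter_filter \<nu>_def cong: if_cong)
    also have "\<dots> \<le> 4 / y\<^sup>2 * (\<integral>u. (cmod (g y u))\<^sup>2 \<partial>M) + 2 * K * v"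
    proof (intro add_mono mult_left_mono)
      show "(\<Sum>n\<in>S. w n * (F (g y) n)\<^sup>2) \<le> (\<integral>u. (cmod (g y u))\<^sup>2 \<partial>M)"
        by (rule L2[OF _ gb]) simp
      show "(\<Sum>n\<in>{n \<in> S. \<tau> n \<le> v}. w n * (\<tau> n)\<^sup>2) \<le> 2 * K * v"
        using S w \<tau> K y by (intro sum_squares_le_of_level_bound) (auto simp: v_def)
    qed simp
    also have "\<dots> = (\<integral>u. 4 / y\<^sup>2 * (cmod (g y u))\<^sup>2 + 4 * K / y * cmod (h y u) \<partial>M)"
      using int_g2[of y] int_h[of y]
      by (subst Bochner_Integration.integral_add) (auto simp: v_def)
    finally show ?thesis .
  qed
  \<comment> \<open>The square in \<open>\<nu> n\<close> divided by \<open>\<tau> n powr p\<close>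
    leaves the exponent 2 - p; where \<open>\<tau> n = 0\<close> both sides vanish by
    \<open>0 powr a = 0\<close>.\<close>
  have "(\<Sum>n\<in>S. w n * F f n powr p * \<tau> n powr (2 - p)) = (\<Sum>n\<in>S. \<nu> n * G n powr p)"
  proof (intro sum.cong refl)
    fix n assume "n \<in> S"
    show "w n * F f n powr p * \<tau> n powr (2 - p) = \<nu> n * G n powr p"
    proof (cases "\<tau> n = 0")
      case False
      then show ?thesis
        using nonneg[of f n] \<tau>[OF \<open>n \<in> S\<close>]
        by (simp add: \<nu>_def G_def powr_divide powr_diff powr_numeral)
    qed (use p in \<open>simp add: \<nu>_def\<close>)
  qed
  also have "ennreal \<dots> = (\<integral>\<^sup>+y. ennreal (p * y powr (p - 1)) * ennreal (\<Sum>n\<in>S. \<nu> n * indicator {0<..<G n} y) \<partial>lborel)"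
    using p w \<tau> nonneg by (intro sum_nn_integral_layers) (auto simp: \<nu>_def G_def)
  also have "\<dots> \<le> (\<integral>\<^sup>+y. (\<integral>\<^sup>+u. H y u \<partial>M) \<partial>lborel)"
  proof (intro nn_integral_mono)
    fix y :: real
    show "ennreal (p * y powr (p - 1)) * ennreal (\<Sum>n\<in>S. \<nu> n * indicator {0<..<G n} y) \<le> (\<integral>\<^sup>+u. H y u \<partial>M)"
    proof (cases "0 < y")
      case True
      have "ennreal (p * y powr (p - 1)) * ennreal (\<Sum>n\<in>S. \<nu> n * indicator {0<..<G n} y)
         \<le> ennreal (p * y powr (p - 1)) * ennreal (\<integral>u. 4 / y\<^sup>2 * (cmod (g y u))\<^sup>2 + 4 * K / y * cmod (h y u) \<partial>M)"
        by (intro mult_left_mono ennreal_leI pointwise True) simp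
      also have "\<dots> = ennreal (p * y powr (p - 1)) * (\<integral>\<^sup>+u. ennreal (4 / y\<^sup>2 * (cmod (g y u))\<^sup>2 + 4 * K / y * cmod (h y u)) \<partial>M)"
        using int_g2[of y] int_h[of y] True K
        by (subst nn_integral_eq_integral) auto
      also have "\<dots> = (\<integral>\<^sup>+u. H y u \<partial>M)"
        using True by (subst nn_integral_cmult[symmetric]) (auto simp: H_def intro!: nn_integral_cong)
      finally show ?thesis .
    next
      case False
      then have "(\<Sum>n\<in>S. \<nu> n * indicator {0<..<G n} y) = 0"
        by (intro sum.neutral) auto
      then show ?thesis
        by simp
    qed
  qed
  \<comment> \<open>Tonelli: once \<open>u\<close> is fixed, the truncation condition cuts the
    half-line of levels at \<open>cmod (f u) / K\<close> and leaves two explicit power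
    integrals.\<close>
  also have "\<dots> = (\<integral>\<^sup>+u. (\<integral>\<^sup>+y. H y u \<partial>lborel) \<partial>M)"
    by (rule P.Fubini'[symmetric]) (unfold H_def g_def h_def, measurable)
  also have "\<dots> = (\<integral>\<^sup>+u. ennreal ((4 * p / (2 - p) + 4 * p / (p - 1)) * K powr (2 - p) * cmod (f u) powr p) \<partial>M)"
  proof (intro nn_integral_cong)
    fix u
    have "(\<integral>\<^sup>+y. H y u \<partial>lborel) = (\<integral>\<^sup>+y.
        ennreal (p * y powr (p - 1)) * ennreal (4 / y\<^sup>2 * (cmod (f u))\<^sup>2) * indicator {y. 0 < y \<and> cmod (f u) \<le> K * y} y
        + ennreal (p * y powr (p - 1)) * ennreal (4 * K / y * cmod (f u)) * indicator {y. 0 < y \<and> K * y < cmod (f u)} y \<partial>lborel)"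
      by (intro nn_integral_cong) (auto simp: H_def g_def h_def split: split_indicator)
    also have "\<dots> = ennreal (4 * p / (2 - p) * K powr (2 - p) * cmod (f u) powr p)
        + ennreal (4 * p / (p - 1) * K powr (2 - p) * cmod (f u) powr p)"
      using nn_integral_low_layers[OF p K(1), of "cmod (f u)"] nn_integral_high_layers[OF p K(1), of "cmod (f u)"]
      by (subst nn_integral_add) auto
    also have "\<dots> = ennreal ((4 * p / (2 - p) + 4 * p / (p - 1)) * K powr (2 - p) * cmod (f u) powr p)"
      using p by (subst ennreal_plus[symmetric]) (auto simp: distrib_right)
    finally show "(\<integral>\<^sup>+y. H y u \<partial>lborel) = ennreal ((4 * p / (2 - p) + 4 * p / (p - 1)) * K powr (2 - p) * cmod (f u) powr p)" .
  qed
  also have "\<dots> = ennreal ((4 * p / (2 - p) + 4 * p / (p - 1)) * K powr (2 - p) * (\<integral>u. cmod (f u) powr p \<partial>M))"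
    using fp p by (subst nn_integral_eq_integral) auto
  finally show ?thesis
    using p by (subst (asm) ennreal_le_iff) (auto intro!: mult_nonneg_nonneg)
qed

section \<open>Intertwiners of homogeneous polynomials\<close>

definition hom_monom :: "nat \<Rightarrow> nat \<Rightarrow> complex^2 \<Rightarrow> complex" where
  "hom_monom n k z = vec_nth z 1 ^ k * vec_nth z 2 ^ (n - k)"

definition hom_poly :: "nat \<Rightarrow> (nat \<Rightarrow> complex) \<Rightarrow> complex^2 \<Rightarrow> complex" where
  "hom_poly n c z = (\<Sum>k\<le>n. c k * hom_monom n k z)"

lemma hom_polys_iff: "P \<in> hom_polys n \<longleftrightarrow> (\<exists>c. P = hom_poly n c)"
  by (simp add: hom_polys_def hom_poly_def[abs_def] hom_monom_def mult.assoc)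

lemma hom_poly_vector: "hom_poly n c (vector [x, 1]) = (\<Sum>k\<le>n. c k * x ^ k)"
  by (simp add: hom_poly_def hom_monom_def)

text \<open>Dehomogenizing at \<open>vector [x, 1]\<close> reduces the claim to uniqueness of the
  coefficients of a polynomial in one variable.\<close>

lemma hom_poly_eqD:
  assumes "hom_poly n c = hom_poly n d" "k \<le> n"
  shows "c k = d k"
proof -
  have "\<forall>x. (\<Sum>k\<le>n. c k * x ^ k) = (\<Sum>k\<le>n. d k * x ^ k)"
    by (metis assms(1) hom_poly_vector)
  then show ?thesis
    using assms(2) by (simp add: polyfun_eq_coeffs)
qed

text \<open>Orthogonality of the characters of the cyclic group of order \<open>n + 1\<close>, by a
  geometric sum. The bounds on \<open>j\<close> and \<open>k\<close> keep |j - k| below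
  \<open>n + 1\<close>, so distinct exponents give distinct characters.\<close>

lemma sum_cis_multiples:
  fixes j k n :: nat
  assumes "j \<le> n" "k \<le> n"
  shows "(\<Sum>r\<le>n. cis (2 * pi * r * j / (n + 1)) * cis (- (2 * pi * r * k / (n + 1))))
    = (if j = k then of_nat (n + 1) else 0)"
proof -
  define \<theta> where "\<theta> = 2 * pi * (real j - real k) / real (n + 1)"
  have "cis (2 * pi * r * j / (n + 1)) * cis (- (2 * pi * r * k / (n + 1))) = cis \<theta> ^ r" for r :: nat
    unfolding Complex.DeMoivre cis_mult by (simp add: \<theta>_def algebra_simps diff_divide_distrib)
  then have eq: "(\<Sum>r\<le>n. cis (2 * pi * r * j / (n + 1)) * cis (- (2 * pi * r * k / (n + 1))))
    = (\<Sum>r<Suc n. cis \<theta> ^ r)"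
    by (simp add: lessThan_Suc_atMost)
  show ?thesis
  proof (cases "j = k")
    case True
    then show ?thesis
      unfolding eq by (simp add: \<theta>_def)
  next
    case False
    have "cis \<theta> \<noteq> 1"
    proof
      assume "cis \<theta> = 1"
      then have "cos \<theta> = 1"
        by (simp add: complex_eq_iff)
      then obtain i :: int where "\<theta> = i * (2 * pi)"
        by (auto simp: cos_one_2pi_int)
      then have "2 * pi * (real j - real k) = 2 * pi * (of_int i * real (n + 1))"
        unfolding \<theta>_def by (subst (asm) nonzero_divide_eq_eq) (auto simp: mult_ac)
      then have "real j - real k = of_int i * real (n + 1)"
        by (subst (asm) mult_left_cancel) auto
      then have "real_of_int (int j - int k) = real_of_int (i * int (n + 1))"
        by simp
      then have i: "int j - int k = i * int (n + 1)"
        by (simp only: of_int_eq_iff)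
      then have "int (n + 1) dvd int j - int k"
        by simp
      moreover have "\<bar>int j - int k\<bar> < int (n + 1)"
        using assms by auto
      ultimately have "int j - int k = 0"
        using dvd_imp_le_int[of "int j - int k" "int (n + 1)"] by linarith
      then show False
        using False by simp
    qed
    moreover have "cis \<theta> ^ Suc n = 1"
    proof -
      have "cis \<theta> ^ Suc n = cis (real (Suc n) * \<theta>)"
        by (rule Complex.DeMoivre)
      also have "real (Suc n) * \<theta> = 2 * pi * of_int (int j - int k)"
        by (simp add: \<theta>_def field_simps)
      also have "cis \<dots> = 1"
        by (intro cis_multiple_2pi) auto
      finally show ?thesis .
    qed
    ultimately show ?thesis
      unfolding eq using False by (subst geometric_sum) auto
  qed
qed

text \<open>Inverse discrete Fourier transform: a coefficient is a fixed finite combination of point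
  values and so inherits their continuity in a parameter.\<close>

lemma hom_poly_coeff:
  fixes k n :: nat
  assumes "k \<le> n"
  shows "(\<Sum>r\<le>n. hom_poly n c (vector [cis (2 * pi * r / (n + 1)), 1]) * cis (- (2 * pi * r * k / (n + 1))))
    = of_nat (n + 1) * c k"
proof -
  have "(\<Sum>r\<le>n. hom_poly n c (vector [cis (2 * pi * r / (n + 1)), 1]) * cis (- (2 * pi * r * k / (n + 1))))
    = (\<Sum>r\<le>n. \<Sum>j\<le>n. c j * (cis (2 * pi * r * j / (n + 1)) * cis (- (2 * pi * r * k / (n + 1)))))"
  proof (intro sum.cong refl)
    fix r :: nat
    have "cis (2 * pi * r / (n + 1)) ^ j = cis (2 * pi * r * j / (n + 1))" for j :: nat
      unfolding Complex.DeMoivre by (simp add: mult_ac)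
    then show "hom_poly n c (vector [cis (2 * pi * r / (n + 1)), 1]) * cis (- (2 * pi * r * k / (n + 1)))
      = (\<Sum>j\<le>n. c j * (cis (2 * pi * r * j / (n + 1)) * cis (- (2 * pi * r * k / (n + 1)))))"
      by (simp only: hom_poly_vector sum_distrib_right mult.assoc)
  qed
  also have "\<dots> = (\<Sum>j\<le>n. c j * (\<Sum>r\<le>n. cis (2 * pi * r * j / (n + 1)) * cis (- (2 * pi * r * k / (n + 1)))))"
    by (subst sum.swap) (simp only: sum_distrib_left)
  also have "\<dots> = (\<Sum>j\<le>n. c j * (if j = k then of_nat (n + 1) else 0))"
    using assms by (intro sum.cong refl arg_cong2[where f="(*)"] sum_cis_multiples) auto
  also have "\<dots> = of_nat (n + 1) * c k"
    using assms by (simp add: if_distrib cong: if_cong)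
  finally show ?thesis .
qed

section \<open>Elements of SU(2) and their action on monomials\<close>

lemma SU2_mult:
  assumes "g \<in> SU2" "u \<in> SU2"
  shows "g ** u \<in> SU2"
proof -
  have adj: "transpose (map_matrix cnj (g ** u)) = transpose (map_matrix cnj u) ** transpose (map_matrix cnj g)"
    by (simp add: Finite_Cartesian_Product.vec_eq_iff matrix_matrix_mult_def Finite_Cartesian_Product.transpose_def map_matrix_def mult.commute)
  have "(g ** u) ** transpose (map_matrix cnj (g ** u))
      = g ** (u ** transpose (map_matrix cnj u)) ** transpose (map_matrix cnj g)"
    by (simp add: adj matrix_mul_assoc)
  then show ?thesis
    using assms by (simp add: SU2_def det_mul)
qed

definition SU2_torus :: "complex \<Rightarrow> complex^2^2" where
  "SU2_torus w = vector [vector [w, 0], vector [0, cnj w]]"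

text \<open>Any rotation without zero entries would do for the Schur argument; a Pythagorean triple keeps it rational.\<close>

definition SU2_rot :: "complex^2^2" where
  "SU2_rot = vector [vector [3 / 5, 4 / 5], vector [- (4 / 5), 3 / 5]]"

lemma SU2_torus: "cmod w = 1 \<Longrightarrow> SU2_torus w \<in> SU2"
  using complex_norm_square[of w] unfolding SU2_def mem_Collect_eq Finite_Cartesian_Product.vec_eq_iff forall_2
  by (simp add: SU2_torus_def matrix_matrix_mult_def sum_2 det_2
      Finite_Cartesian_Product.transpose_def map_matrix_def Finite_Cartesian_Product.mat_def mult.commute)

lemma SU2_rot: "SU2_rot \<in> SU2"
  unfolding SU2_def mem_Collect_eq Finite_Cartesian_Product.vec_eq_iff forall_2
  by (simp add: SU2_rot_def matrix_matrix_mult_def sum_2 det_2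
      Finite_Cartesian_Product.transpose_def map_matrix_def Finite_Cartesian_Product.mat_def)

text \<open>Monomials are the weight vectors: for \<open>cmod w = 1\<close> the eigenvalue is w^(2k
  - n).\<close>

lemma SU2_act_torus:
  "SU2_act (SU2_torus w) (hom_monom n k) z = w ^ k * cnj w ^ (n - k) * hom_monom n k z"
  by (simp add: SU2_act_def hom_monom_def SU2_torus_def vector_matrix_mult_def sum_2 power_mult_distrib mult_ac)

text \<open>Binomial theorem; as 3/5 and -4/5 are both non-zero, every monomial occurs in the
  image.\<close>

lemma SU2_act_rot:
  "SU2_act SU2_rot (hom_monom n n) = hom_poly n (\<lambda>k. of_nat (n choose k) * (3 / 5) ^ k * (- (4 / 5)) ^ (n - k))"
proof
  fix z :: "complex^2"
  have "SU2_act SU2_rot (hom_monom n n) z = (3 / 5 * vec_nth z 1 + - (4 / 5) * vec_nth z 2) ^ n"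
    by (simp add: SU2_act_def hom_monom_def SU2_rot_def vector_matrix_mult_def sum_2 mult_ac)
  also have "\<dots> = hom_poly n (\<lambda>k. of_nat (n choose k) * (3 / 5) ^ k * (- (4 / 5)) ^ (n - k)) z"
    unfolding hom_poly_def hom_monom_def binomial_ring
    by (intro sum.cong refl) (simp only: power_mult_distrib mult_ac)
  finally show "SU2_act SU2_rot (hom_monom n n) z
    = hom_poly n (\<lambda>k. of_nat (n choose k) * (3 / 5) ^ k * (- (4 / 5)) ^ (n - k)) z" .
qed

text \<open>The weights 2j - n and 2k - m differ by at most n + m, so at the angle 1 / (n + m + 1)
  their phases differ by less than 1, short of a full turn: a single torus element separates all
  weights of both degrees. The conclusion avoids subtraction of naturals.\<close>

lemma cis_weight_eqD:
  assumes "j \<le> n" "k \<le> m" "w = cis (1 / (real n + real m + 1))"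
    "w ^ j * cnj w ^ (n - j) = w ^ k * cnj w ^ (m - k)"
  shows "2 * j + m = 2 * k + n"
proof -
  have pw: "w ^ i * cnj w ^ (N - i) = cis ((2 * real i - real N) / (real n + real m + 1))" if "i \<le> N" for i N
  proof -
    have "w ^ i * cnj w ^ (N - i) = cis (real i * (1 / (real n + real m + 1)) + real (N - i) * - (1 / (real n + real m + 1)))"
      unfolding assms(3) cis_cnj Complex.DeMoivre cis_mult ..
    also have "real i * (1 / D) + real (N - i) * - (1 / D) = (2 * real i - real N) / D" for D :: real
    proof -
      have "real i * (1 / D) + real (N - i) * - (1 / D) = (real i - real (N - i)) / D"
        by (simp add: diff_divide_distrib)
      also have "real i - real (N - i) = 2 * real i - real N"
        using that by simp
      finally show ?thesis .
    qed
    finally show ?thesis .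
  qed
  let ?d = "((2 * real j - real n) - (2 * real k - real m)) / (real n + real m + 1)"
  have "cis ?d = cis ((2 * real j - real n) / (real n + real m + 1)) / cis ((2 * real k - real m) / (real n + real m + 1))"
    by (simp add: cis_divide diff_divide_distrib)
  also have "\<dots> = 1"
    using assms pw[of j n] pw[of k m] by simp
  finally have "cos ?d = 1"
    by (simp add: complex_eq_iff)
  then obtain i :: int where i: "?d = i * (2 * pi)"
    by (auto simp: cos_one_2pi_int)
  have "\<bar>?d\<bar> < 1"
    using assms by (simp add: field_simps abs_less_iff)
  then have "\<bar>of_int i\<bar> * (2 * pi) < 1"
    unfolding i by (simp add: abs_mult)
  have "i = 0"
  proof (rule ccontr)
    assume "i \<noteq> 0"
    then have "1 \<le> \<bar>real_of_int i\<bar>"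
      by linarith
    then have "1 * (2 * pi) \<le> \<bar>of_int i\<bar> * (2 * pi)"
      by (intro mult_right_mono) auto
    then show False
      using \<open>\<bar>of_int i\<bar> * (2 * pi) < 1\<close> pi_gt3 by linarith
  qed
  then have "real (2 * j + m) = real (2 * k + n)"
    using i by simp
  then show ?thesis
    by (simp only: of_nat_eq_iff)
qed

lemma hom_poly_single: "k \<le> n \<Longrightarrow> hom_poly n (\<lambda>i. if i = k then c else 0) = (\<lambda>z. c * hom_monom n k z)"
  by (simp add: hom_poly_def fun_eq_iff if_distrib[of "\<lambda>x. x * _"] cong: if_cong)

lemma SU2_act_hom_poly:
  "SU2_act u (hom_poly n c) = (\<lambda>z. \<Sum>k\<le>n. c k * SU2_act u (hom_monom n k) z)"
  by (simp add: SU2_act_def hom_poly_def)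

text \<open>Torus elements force an intertwiner to preserve weights, so it is diagonal on monomials;
  a rotation moving the highest weight vector into every weight space links the diagonal entries.\<close>

lemma intertwiner_hom_monom:
  assumes lin: "\<And>c. L (hom_poly m c) = (\<lambda>z. \<Sum>k\<le>m. c k * L (hom_monom m k) z)"
    and a: "\<And>k. k \<le> m \<Longrightarrow> L (hom_monom m k) = hom_poly n (a k)"
    and comm: "\<And>g k. g \<in> SU2 \<Longrightarrow> k \<le> m \<Longrightarrow>
      L (SU2_act g (hom_monom m k)) = SU2_act g (L (hom_monom m k))"
    and le: "n \<le> m" and k: "k \<le> m" and j: "j \<le> n"
  shows "a k j = (if n = m \<and> j = k then a m m else 0)"
proof -
  \<comment> \<open>Monomials are torus eigenvectors in both degrees; comparing coefficient
    \<open>j\<close> equates two eigenvalues as soon as \<open>a k j\<close> is non-zero.\<close>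
  have weight: "2 * j + m = 2 * k + n" if "a k j \<noteq> 0" and k: "k \<le> m" and j: "j \<le> n" for j k
  proof -
    define w where "w = cis (1 / (real n + real m + 1))"
    let ?s = "w ^ k * cnj w ^ (m - k)"
    have T: "SU2_torus w \<in> SU2"
      by (simp add: SU2_torus w_def)
    have "hom_poly n (\<lambda>i. ?s * a k i) = L (SU2_act (SU2_torus w) (hom_monom m k))"
    proof -
      have "SU2_act (SU2_torus w) (hom_monom m k) = hom_poly m (\<lambda>i. if i = k then ?s else 0)"
        using k by (auto simp: hom_poly_single SU2_act_torus)
      then have "L (SU2_act (SU2_torus w) (hom_monom m k)) = (\<lambda>z. ?s * L (hom_monom m k) z)"
        using k by (simp add: lin if_distrib[of "\<lambda>x. x * _"] cong: if_cong)
      then show ?thesis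
        using k by (simp add: a hom_poly_def fun_eq_iff sum_distrib_left mult_ac)
    qed
    also have "\<dots> = SU2_act (SU2_torus w) (hom_poly n (a k))"
      using comm[OF T k] by (simp add: a k)
    also have "\<dots> = hom_poly n (\<lambda>i. (w ^ i * cnj w ^ (n - i)) * a k i)"
      by (simp add: SU2_act_hom_poly SU2_act_torus hom_poly_def fun_eq_iff mult_ac)
    finally have "?s * a k j = (w ^ j * cnj w ^ (n - j)) * a k j"
      using j by (rule hom_poly_eqD)
    then show ?thesis
      using that by (intro cis_weight_eqD[OF j k w_def]) simp
  qed
  define q :: "nat \<Rightarrow> complex" where "q k = of_nat (m choose k) * (3 / 5) ^ k * (- (4 / 5)) ^ (m - k)" for k
  have q: "q k \<noteq> 0" if "k \<le> m" for k
    using that by (simp add: q_def)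
  \<comment> \<open>The weight \<open>m\<close> of the highest monomial occurs in degree
    \<open>n \<le> m\<close> only if \<open>n = m\<close>, so for \<open>n < m\<close> the map
    \<open>L\<close> kills that monomial. This is where \<open>le\<close> enters.\<close>
  have top: "hom_poly n (a m) = (\<lambda>z. (if n = m then a m m else 0) * hom_monom n m z)"
  proof
    fix z
    have "a m i = 0" if "i \<le> n" "i \<noteq> m \<or> n \<noteq> m" for i
      using weight[of m i] that le by auto
    then have "hom_poly n (a m) z = (\<Sum>i\<le>n. if i = m then (if n = m then a m m else 0) * hom_monom n m z else 0)"
      unfolding hom_poly_def by (intro sum.cong refl) auto
    then show "hom_poly n (a m) z = (if n = m then a m m else 0) * hom_monom n m z"
      using le by auto
  qed
  have "hom_poly n (\<lambda>i. \<Sum>k\<le>m. q k * a k i) = L (hom_poly m q)"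
  proof
    fix z
    have "L (hom_poly m q) z = (\<Sum>k\<le>m. q k * hom_poly n (a k) z)"
      by (simp add: lin a)
    also have "\<dots> = (\<Sum>i\<le>n. \<Sum>k\<le>m. q k * a k i * hom_monom n i z)"
      unfolding hom_poly_def sum_distrib_left by (subst sum.swap) (simp add: mult.assoc)
    finally show "hom_poly n (\<lambda>i. \<Sum>k\<le>m. q k * a k i) z = L (hom_poly m q) z"
      by (simp add: hom_poly_def sum_distrib_right)
  qed
  also have "hom_poly m q = SU2_act SU2_rot (hom_monom m m)"
    unfolding SU2_act_rot q_def[abs_def] ..
  also have "L \<dots> = SU2_act SU2_rot (hom_poly n (a m))"
    using comm[OF SU2_rot, of m] by (simp add: a)
  also have "\<dots> = (\<lambda>z. (if n = m then a m m else 0) * SU2_act SU2_rot (hom_monom n m) z)"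
    unfolding top by (simp add: SU2_act_def)
  also have "\<dots> = hom_poly n (\<lambda>i. (if n = m then a m m else 0) * q i)"
    using SU2_act_rot[of m] by (auto simp: hom_poly_def q_def sum_distrib_left mult_ac)
  finally have eq: "(\<Sum>k\<le>m. q k * a k j) = (if n = m then a m m else 0) * q j"
    using j by (rule hom_poly_eqD)
  \<comment> \<open>For fixed \<open>j\<close> only the index \<open>k\<close> of matching weight
    can contribute, so the sum identity becomes one between single entries; cancelling
    \<open>q k\<close> then determines \<open>a k j\<close>.\<close>
  have single: "q k * a k j = (if n = m then a m m else 0) * q j" if w: "2 * j + m = 2 * k + n"
  proof -
    have "a k' j = 0" if "k' \<le> m" "k' \<noteq> k" for k'
    proof (rule ccontr)
      assume "a k' j \<noteq> 0"
      from weight[OF this that(1) j] w that(2) show False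
        by simp
    qed
    then have "(\<Sum>k'\<le>m. q k' * a k' j) = (\<Sum>k'\<le>m. if k' = k then q k * a k j else 0)"
      by (intro sum.cong refl) auto
    then show ?thesis
      using eq k by simp
  qed
  consider "a k j = 0" "\<not> (n = m \<and> j = k)" | "2 * j + m = 2 * k + n"
    using weight[OF _ k j] by fastforce
  then show ?thesis
  proof cases
    case 1
    then show ?thesis
      by (subst if_not_P) auto
  next
    case 2
    show ?thesis
    proof (cases "n = m")
      case True
      then show ?thesis
        using single[OF 2] 2 q[OF k] by simp
    next
      case False
      then show ?thesis
        using single[OF 2] q[OF k] by simp
    qed
  qed
qed

section \<open>Matrix coefficients of unitary representations\<close>

lemma lin_comb_eqD:
  assumes "hom_polys_basis n b" "lin_comb n b c = lin_comb n b d" "i \<le> n"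
  shows "c i = d i"
proof -
  have "lin_comb n b (\<lambda>i. c i - d i) = (\<lambda>z. lin_comb n b c z - lin_comb n b d z)"
    by (simp add: lin_comb_def left_diff_distrib sum_subtractf)
  then have "lin_comb n b (\<lambda>i. c i - d i) = (\<lambda>z. 0)"
    using assms(2) by simp
  then have "\<forall>i\<le>n. c i - d i = 0"
    using assms(1) unfolding hom_polys_basis_def by (elim conjE allE[of _ "\<lambda>i. c i - d i"]) blast
  then show ?thesis
    using assms(3) by simp
qed

lemma lin_comb_single: "k \<le> n \<Longrightarrow> lin_comb n b (\<lambda>i. if i = k then c else 0) = (\<lambda>z. c * b k z)"
  by (simp add: lin_comb_def fun_eq_iff if_distrib[of "\<lambda>x. x * _"] cong: if_cong)

lemma SU2_act_lin_comb:
  assumes "\<And>j. j \<le> n \<Longrightarrow> SU2_act u (b j) = lin_comb n b (\<lambda>i. T i j)"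
  shows "SU2_act u (lin_comb n b c) = lin_comb n b (\<lambda>i. \<Sum>j\<le>n. T i j * c j)"
proof
  fix z
  have "SU2_act u (lin_comb n b c) z = (\<Sum>j\<le>n. c j * SU2_act u (b j) z)"
    by (simp add: SU2_act_def lin_comb_def)
  also have "\<dots> = (\<Sum>j\<le>n. \<Sum>i\<le>n. T i j * c j * b i z)"
    by (intro sum.cong refl) (simp add: assms lin_comb_def sum_distrib_left mult_ac)
  also have "\<dots> = (\<Sum>i\<le>n. \<Sum>j\<le>n. T i j * c j * b i z)"
    by (rule sum.swap)
  also have "\<dots> = lin_comb n b (\<lambda>i. \<Sum>j\<le>n. T i j * c j) z"
    by (simp add: lin_comb_def sum_distrib_right)
  finally show "SU2_act u (lin_comb n b c) z = lin_comb n b (\<lambda>i. \<Sum>j\<le>n. T i j * c j) z" .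
qed

lemma lin_comb_in_hom_polys:
  assumes "hom_polys_basis n b"
  shows "lin_comb n b x \<in> hom_polys n"
proof -
  have "\<forall>i\<le>n. \<exists>c. b i = hom_poly n c"
    using assms by (auto simp: hom_polys_basis_def hom_polys_iff)
  then obtain c where c: "\<And>i. i \<le> n \<Longrightarrow> b i = hom_poly n (c i)"
    by metis
  have "lin_comb n b x z = hom_poly n (\<lambda>k. \<Sum>i\<le>n. x i * c i k) z" for z
  proof -
    have "lin_comb n b x z = (\<Sum>i\<le>n. \<Sum>k\<le>n. x i * c i k * hom_monom n k z)"
      by (simp add: lin_comb_def c hom_poly_def sum_distrib_left mult.assoc)
    also have "\<dots> = hom_poly n (\<lambda>k. \<Sum>i\<le>n. x i * c i k) z"
      by (subst sum.swap) (simp add: hom_poly_def sum_distrib_right)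
    finally show ?thesis .
  qed
  then show ?thesis
    unfolding hom_polys_iff by blast
qed

lemma hom_poly_lin_comb:
  assumes "\<And>k. k \<le> n \<Longrightarrow> hom_monom n k = lin_comb n b (s k)"
  shows "hom_poly n c = lin_comb n b (\<lambda>i. \<Sum>k\<le>n. c k * s k i)"
proof
  fix z
  have "hom_poly n c z = (\<Sum>k\<le>n. \<Sum>i\<le>n. c k * s k i * b i z)"
    by (simp add: hom_poly_def assms lin_comb_def sum_distrib_left mult.assoc)
  also have "\<dots> = lin_comb n b (\<lambda>i. \<Sum>k\<le>n. c k * s k i) z"
    by (subst sum.swap) (simp add: lin_comb_def sum_distrib_right)
  finally show "hom_poly n c z = lin_comb n b (\<lambda>i. \<Sum>k\<le>n. c k * s k i) z" .
qed

lemma hom_polys_basis_monomE: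
  assumes "hom_polys_basis n b"
  obtains s where "\<And>k. k \<le> n \<Longrightarrow> hom_monom n k = lin_comb n b (s k)"
proof -
  have "\<exists>c. hom_monom n k = lin_comb n b c" if "k \<le> n" for k
  proof -
    have "hom_monom n k = hom_poly n (\<lambda>i. if i = k then 1 else 0)"
      using hom_poly_single[OF that, of 1] by simp
    then have "hom_monom n k \<in> hom_polys n"
      unfolding hom_polys_iff by blast
    then show ?thesis
      using assms by (simp add: hom_polys_basis_def)
  qed
  then show thesis
    using that by metis
qed

section \<open>Entries of the representing matrices\<close>

lemma SU2_unitary_repE:
  assumes "SU2_unitary_rep n T"
  obtains b where "hom_polys_basis n b"
    "\<And>u j. u \<in> SU2 \<Longrightarrow> j \<le> n \<Longrightarrow> SU2_act u (b j) = lin_comb n b (\<lambda>i. T u $$ (i, j))"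
  using assms unfolding SU2_unitary_rep_def by blast

lemma mat_adjoint_index:
  assumes "A \<in> carrier_mat n n" "i < n" "j < n"
  shows "mat_adjoint (A :: complex mat) $$ (i, j) = cnj (A $$ (j, i))"
  using assms by (simp add: mat_adjoint_def mat_of_rows_def)

lemma mat_adjoint_carrier: "A \<in> carrier_mat n n \<Longrightarrow> mat_adjoint (A :: complex mat) \<in> carrier_mat n n"
  by (simp add: mat_adjoint_def mat_of_rows_def)

lemma mat_mult_index_sum:
  assumes "A \<in> carrier_mat (n + 1) (n + 1)" "B \<in> carrier_mat (n + 1) (n + 1)" "i \<le> n" "j \<le> n"
  shows "(A * B) $$ (i, j) = (\<Sum>k\<le>n. A $$ (i, k) * B $$ (k, j))"
  using assms by (simp add: scalar_prod_def atLeast0LessThan lessThan_Suc_atMost)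

lemma SU2_unitary_rep_carrier:
  "SU2_unitary_rep n T \<Longrightarrow> u \<in> SU2 \<Longrightarrow> T u \<in> carrier_mat (n + 1) (n + 1)"
  unfolding SU2_unitary_rep_def by blast

lemma SU2_unitary_rep_rows:
  assumes "SU2_unitary_rep n T" "u \<in> SU2" "i \<le> n" "j \<le> n"
  shows "(\<Sum>k\<le>n. T u $$ (i, k) * cnj (T u $$ (j, k))) = (if i = j then 1 else 0)"
proof -
  have T: "T u \<in> carrier_mat (n + 1) (n + 1)" "T u * mat_adjoint (T u) = 1\<^sub>m (n + 1)"
    using assms unfolding SU2_unitary_rep_def by blast+
  have "(T u * mat_adjoint (T u)) $$ (i, j) = (\<Sum>k\<le>n. T u $$ (i, k) * mat_adjoint (T u) $$ (k, j))"
    by (rule mat_mult_index_sum[OF T(1) mat_adjoint_carrier[OF T(1)] assms(3,4)])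
  also have "\<dots> = (\<Sum>k\<le>n. T u $$ (i, k) * cnj (T u $$ (j, k)))"
    using assms by (intro sum.cong refl) (simp add: mat_adjoint_index[OF T(1)])
  finally show ?thesis
    using assms by (simp add: T)
qed

text \<open>The definition makes the rows orthonormal; for square matrices a right inverse is also a
  left inverse, which transfers this to the columns.\<close>

lemma SU2_unitary_rep_cols:
  assumes "SU2_unitary_rep n T" "u \<in> SU2" "i \<le> n" "j \<le> n"
  shows "(\<Sum>k\<le>n. T u $$ (k, i) * cnj (T u $$ (k, j))) = (if i = j then 1 else 0)"
proof -
  have T: "T u \<in> carrier_mat (n + 1) (n + 1)" "T u * mat_adjoint (T u) = 1\<^sub>m (n + 1)"
    using assms unfolding SU2_unitary_rep_def by blast+
  have T': "mat_adjoint (T u) * T u = 1\<^sub>m (n + 1)"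
    by (rule mat_mult_left_right_inverse[OF T(1) mat_adjoint_carrier[OF T(1)] T(2)])
  have "(mat_adjoint (T u) * T u) $$ (j, i) = (\<Sum>k\<le>n. mat_adjoint (T u) $$ (j, k) * T u $$ (k, i))"
    by (rule mat_mult_index_sum[OF mat_adjoint_carrier[OF T(1)] T(1) assms(4,3)])
  also have "\<dots> = (\<Sum>k\<le>n. T u $$ (k, i) * cnj (T u $$ (k, j)))"
    using assms by (intro sum.cong refl) (simp add: mat_adjoint_index[OF T(1)])
  finally show ?thesis
    using assms by (auto simp: T')
qed

lemma SU2_unitary_rep_le_1:
  assumes "SU2_unitary_rep n T" "u \<in> SU2" "i \<le> n" "j \<le> n"
  shows "cmod (T u $$ (i, j)) \<le> 1"
proof -
  have "(\<Sum>k\<le>n. (cmod (T u $$ (i, k)))\<^sup>2) = 1"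
  proof -
    have "complex_of_real (\<Sum>k\<le>n. (cmod (T u $$ (i, k)))\<^sup>2) = (\<Sum>k\<le>n. T u $$ (i, k) * cnj (T u $$ (i, k)))"
      by (simp only: of_real_sum complex_norm_square)
    also have "\<dots> = 1"
      using SU2_unitary_rep_rows[OF assms(1,2,3,3)] by simp
    finally show ?thesis
      by (simp only: of_real_eq_1_iff)
  qed
  moreover have "(cmod (T u $$ (i, j)))\<^sup>2 \<le> (\<Sum>k\<le>n. (cmod (T u $$ (i, k)))\<^sup>2)"
    using assms by (intro member_le_sum) auto
  ultimately show ?thesis
    by (simp add: abs_square_le_1)
qed

text \<open>On row vectors (z g) u = z (g u), so the action is a homomorphism in this order.
  Uniqueness of coordinates turns the identity of operators into one of entries.\<close>

lemma SU2_unitary_rep_mult: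
  assumes "SU2_unitary_rep n T" "g \<in> SU2" "u \<in> SU2" "i \<le> n" "j \<le> n"
  shows "T (g ** u) $$ (i, j) = (\<Sum>k\<le>n. T g $$ (i, k) * T u $$ (k, j))"
proof -
  from assms(1) obtain b where b: "hom_polys_basis n b"
    "\<And>u j. u \<in> SU2 \<Longrightarrow> j \<le> n \<Longrightarrow> SU2_act u (b j) = lin_comb n b (\<lambda>i. T u $$ (i, j))"
    by (rule SU2_unitary_repE) (rule that; assumption)
  have "lin_comb n b (\<lambda>i. T (g ** u) $$ (i, j)) = SU2_act (g ** u) (b j)"
    using assms SU2_mult b(2) by simp
  also have "\<dots> = SU2_act g (SU2_act u (b j))"
    by (simp add: SU2_act_def vector_matrix_mul_assoc)
  also have "\<dots> = SU2_act g (lin_comb n b (\<lambda>k. T u $$ (k, j)))"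
    using assms b(2) by simp
  also have "\<dots> = lin_comb n b (\<lambda>i. \<Sum>k\<le>n. T g $$ (i, k) * T u $$ (k, j))"
    using assms b(2) by (intro SU2_act_lin_comb) auto
  finally show ?thesis
    by (rule lin_comb_eqD[OF b(1) _ assms(4)])
qed

text \<open>The basis is arbitrary, so the entries of \<open>T u\<close> are recovered by inverting the discrete Fourier
  transform of the values of the transformed basis polynomials at roots of unity.\<close>

lemma continuous_on_SU2_unitary_rep:
  assumes "SU2_unitary_rep n T" "i \<le> n" "j \<le> n"
  shows "continuous_on SU2 (\<lambda>u. T u $$ (i, j))"
proof -
  from assms(1) obtain b where b: "hom_polys_basis n b"
    "\<And>u j. u \<in> SU2 \<Longrightarrow> j \<le> n \<Longrightarrow> SU2_act u (b j) = lin_comb n b (\<lambda>i. T u $$ (i, j))"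
    by (rule SU2_unitary_repE) (rule that; assumption)
  obtain s where s: "\<And>k. k \<le> n \<Longrightarrow> hom_monom n k = lin_comb n b (s k)"
    using hom_polys_basis_monomE[OF b(1)] by blast
  obtain c where c: "b j = hom_poly n c"
    using b(1) assms(3) by (auto simp: hom_polys_basis_def hom_polys_iff)
  \<comment> \<open>Visibly continuous in \<open>u\<close>; on \<open>SU2\<close> it equals the
    monomial coefficients of \<open>SU2_act u (b j)\<close>, which \<open>s\<close> converts back to
    the unknown basis.\<close>
  define d where "d u k = (\<Sum>r\<le>n. b j (vector [cis (2 * pi * r / (n + 1)), 1] v* u)
    * cis (- (2 * pi * r * k / (n + 1)))) / of_nat (n + 1)" for u :: "complex^2^2" and k :: nat
  have "T u $$ (i, j) = (\<Sum>k\<le>n. d u k * s k i)" if u: "u \<in> SU2" for u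
  proof -
    have "SU2_act u (b j) \<in> hom_polys n"
      using b(2)[OF u assms(3)] lin_comb_in_hom_polys[OF b(1)] by simp
    then obtain e where e: "SU2_act u (b j) = hom_poly n e"
      unfolding hom_polys_iff by blast
    have "d u k = e k" if "k \<le> n" for k
    proof -
      have "d u k = (\<Sum>r\<le>n. SU2_act u (b j) (vector [cis (2 * pi * r / (n + 1)), 1])
          * cis (- (2 * pi * r * k / (n + 1)))) / of_nat (n + 1)"
        by (simp only: d_def SU2_act_def)
      also have "\<dots> = e k"
        unfolding e hom_poly_coeff[OF that]
        by (rule nonzero_mult_div_cancel_left) (simp only: of_nat_eq_0_iff add_is_0 one_neq_zero simp_thms not_False_eq_True)
      finally show ?thesis .
    qed
    then have "(\<lambda>i. \<Sum>k\<le>n. e k * s k i) = (\<lambda>i. \<Sum>k\<le>n. d u k * s k i)"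
      by simp
    then have "lin_comb n b (\<lambda>i. T u $$ (i, j)) = lin_comb n b (\<lambda>i. \<Sum>k\<le>n. d u k * s k i)"
      using b(2)[OF u assms(3)] e hom_poly_lin_comb[where b=b, OF s] by simp
    then show ?thesis
      by (rule lin_comb_eqD[OF b(1) _ assms(2)])
  qed
  then have eq: "(\<Sum>k\<le>n. d u k * s k i) = T u $$ (i, j)" if "u \<in> SU2" for u
    using that by simp
  have cb: "continuous_on SU2 (\<lambda>u. b j (vector [x, 1] v* u))" for x
    unfolding c hom_poly_def hom_monom_def vector_matrix_mult_def sum_2
    by (simp, intro continuous_intros)
  have cd: "continuous_on SU2 (\<lambda>u. d u k)" for k
    unfolding d_def by (intro continuous_on_divide continuous_on_sum continuous_on_mult continuous_on_const cb)
      (intro ballI, simp only: of_nat_eq_0_iff add_is_0 one_neq_zero simp_thms not_False_eq_True)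
  have "continuous_on SU2 (\<lambda>u. \<Sum>k\<le>n. d u k * s k i)"
    by (intro continuous_on_sum continuous_on_mult continuous_on_const cd)
  then show ?thesis
    by (rule continuous_on_eq) (rule eq)
qed

text \<open>Schur's lemma in coordinates: \<open>X\<close> is read as a linear map from degree
  \<open>m\<close> to degree \<open>n\<close> and examined on monomials. In equal degree
  \<open>same\<close> matters: for two different matrix forms of one representation,
  \<open>X\<close> would be a multiple of the change of basis instead of the identity.\<close>

lemma SU2_rep_schur:
  assumes T: "SU2_unitary_rep n T" and T': "SU2_unitary_rep m T'"
    and le: "n \<le> m" and same: "n = m \<Longrightarrow> T = T'"
    and X: "\<And>g i c. g \<in> SU2 \<Longrightarrow> i \<le> n \<Longrightarrow> c \<le> m \<Longrightarrow>
      (\<Sum>k\<le>m. X i k * T' g $$ (k, c)) = (\<Sum>a\<le>n. T g $$ (i, a) * X a c)"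
  shows "\<exists>e. \<forall>i\<le>n. \<forall>k\<le>m. X i k = (if n = m \<and> i = k then e else 0)"
proof -
  obtain b where b: "hom_polys_basis n b"
    "\<And>u j. u \<in> SU2 \<Longrightarrow> j \<le> n \<Longrightarrow> SU2_act u (b j) = lin_comb n b (\<lambda>i. T u $$ (i, j))"
    using T by (rule SU2_unitary_repE) (rule that; assumption)
  obtain b0 where b0: "hom_polys_basis m b0"
    "\<And>u j. u \<in> SU2 \<Longrightarrow> j \<le> m \<Longrightarrow> SU2_act u (b0 j) = lin_comb m b0 (\<lambda>i. T' u $$ (i, j))"
    using T' by (rule SU2_unitary_repE) (rule that; assumption)
  \<comment> \<open>For \<open>n = m\<close> the two bases obtained may differ; using
    \<open>b\<close> on both sides makes a scalar map a scalar matrix.\<close>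
  define b' where "b' = (if n = m then b else b0)"
  have basis': "hom_polys_basis m b'"
    using b(1) b0(1) by (auto simp: b'_def)
  have act': "SU2_act u (b' j) = lin_comb m b' (\<lambda>i. T' u $$ (i, j))" if "u \<in> SU2" "j \<le> m" for u j
    using b(2)[OF that(1)] b0(2)[OF that] that same by (auto simp: b'_def)
  \<comment> \<open>Chosen coordinates; linear independence makes them unique at indices up to
    \<open>m\<close>, so \<open>L\<close> has the matrix \<open>X\<close>.\<close>
  define crd where "crd P = (SOME c. P = lin_comb m b' c)" for P
  define L where "L P = lin_comb n b (\<lambda>i. \<Sum>k\<le>m. X i k * crd P k)" for P
  have crd: "crd (lin_comb m b' c) j = c j" if "j \<le> m" for c j
  proof -
    have "lin_comb m b' c = lin_comb m b' (crd (lin_comb m b' c))"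
      unfolding crd_def by (rule someI[where P="\<lambda>d. lin_comb m b' c = lin_comb m b' d"]) (rule refl)
    then show ?thesis
      using lin_comb_eqD[OF basis' _ that] by metis
  qed
  have L_lin_comb: "L (lin_comb m b' c) = lin_comb n b (\<lambda>i. \<Sum>k\<le>m. X i k * c k)" for c
    by (simp add: L_def crd)
  have L_comm: "L (SU2_act g (lin_comb m b' c)) = SU2_act g (L (lin_comb m b' c))" if g: "g \<in> SU2" for g c
  proof -
    have "L (SU2_act g (lin_comb m b' c)) = L (lin_comb m b' (\<lambda>k. \<Sum>l\<le>m. T' g $$ (k, l) * c l))"
      using act'[OF g] by (simp add: SU2_act_lin_comb)
    also have "\<dots> = lin_comb n b (\<lambda>i. \<Sum>k\<le>m. \<Sum>l\<le>m. X i k * T' g $$ (k, l) * c l)"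
      by (simp add: L_lin_comb sum_distrib_left mult.assoc)
    also have "\<dots> = lin_comb n b (\<lambda>i. \<Sum>l\<le>m. \<Sum>a\<le>n. T g $$ (i, a) * X a l * c l)"
    proof -
      have "(\<Sum>k\<le>m. \<Sum>l\<le>m. X i k * T' g $$ (k, l) * c l) = (\<Sum>l\<le>m. \<Sum>a\<le>n. T g $$ (i, a) * X a l * c l)"
        if "i \<le> n" for i
        by (subst sum.swap) (simp add: sum_distrib_right[symmetric] X[OF g that])
      then show ?thesis
        by (simp add: lin_comb_def)
    qed
    also have "\<dots> = lin_comb n b (\<lambda>i. \<Sum>a\<le>n. T g $$ (i, a) * (\<Sum>l\<le>m. X a l * c l))"
      by (subst sum.swap) (simp add: sum_distrib_left mult.assoc)
    also have "\<dots> = SU2_act g (L (lin_comb m b' c))"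
      using b(2)[OF g] by (simp add: L_lin_comb SU2_act_lin_comb)
    finally show ?thesis .
  qed
  obtain s where s: "\<And>k. k \<le> m \<Longrightarrow> hom_monom m k = lin_comb m b' (s k)"
    using hom_polys_basis_monomE[OF basis'] by blast
  have L_monom: "L (hom_monom m k) z = (\<Sum>i\<le>n. \<Sum>j\<le>m. X i j * s k j * b i z)" if "k \<le> m" for k z
    unfolding s[OF that] L_lin_comb by (simp add: lin_comb_def sum_distrib_right)
  have L_lin: "L (hom_poly m c) = (\<lambda>z. \<Sum>k\<le>m. c k * L (hom_monom m k) z)" for c
  proof
    fix z
    have "hom_poly m c = lin_comb m b' (\<lambda>i. \<Sum>k\<le>m. c k * s k i)"
      by (rule hom_poly_lin_comb) (rule s)
    then have "L (hom_poly m c) z = (\<Sum>i\<le>n. (\<Sum>j\<le>m. X i j * (\<Sum>k\<le>m. c k * s k j)) * b i z)"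
      by (simp only: L_lin_comb) (simp add: lin_comb_def)
    also have "\<dots> = (\<Sum>i\<le>n. \<Sum>j\<le>m. \<Sum>k\<le>m. c k * (X i j * s k j * b i z))"
      by (simp add: sum_distrib_left sum_distrib_right mult_ac)
    also have "\<dots> = (\<Sum>i\<le>n. \<Sum>k\<le>m. \<Sum>j\<le>m. c k * (X i j * s k j * b i z))"
      by (intro sum.cong refl sum.swap)
    also have "\<dots> = (\<Sum>k\<le>m. \<Sum>i\<le>n. \<Sum>j\<le>m. c k * (X i j * s k j * b i z))"
      by (rule sum.swap)
    also have "\<dots> = (\<Sum>k\<le>m. c k * L (hom_monom m k) z)"
      by (intro sum.cong refl) (simp add: L_monom sum_distrib_left)
    finally show "L (hom_poly m c) z = (\<Sum>k\<le>m. c k * L (hom_monom m k) z)" .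
  qed
  have "\<exists>a. L (hom_monom m k) = hom_poly n a" for k
    using lin_comb_in_hom_polys[OF b(1)] unfolding L_def hom_polys_iff by blast
  then obtain a where a: "\<And>k. L (hom_monom m k) = hom_poly n (a k)"
    by metis
  have a_eq: "a k j = (if n = m \<and> j = k then a m m else 0)" if "k \<le> m" "j \<le> n" for k j
    by (rule intertwiner_hom_monom[OF L_lin a _ le that]) (simp add: s L_comm)
  \<comment> \<open>On monomials \<open>L\<close> is now a scalar, or zero if the degrees differ;
    evaluating it at \<open>b' k\<close> brings this back to column \<open>k\<close> of
    \<open>X\<close>.\<close>
  have "X i k = (if n = m \<and> i = k then a m m else 0)" if i: "i \<le> n" and k: "k \<le> m" for i k
  proof -
    obtain c where c: "b' k = hom_poly m c"
      using basis' k by (auto simp: hom_polys_basis_def hom_polys_iff)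
    have "lin_comb n b (\<lambda>i. X i k) = L (b' k)"
    proof -
      have "b' k = lin_comb m b' (\<lambda>i. if i = k then 1 else 0)"
        using lin_comb_single[OF k, of b' 1] by simp
      then have "L (b' k) = L (lin_comb m b' (\<lambda>i. if i = k then 1 else 0))"
        by simp
      then show ?thesis
        using k by (simp add: L_lin_comb if_distrib cong: if_cong)
    qed
    also have "\<dots> = (\<lambda>z. \<Sum>k\<le>m. c k * hom_poly n (a k) z)"
      unfolding c L_lin a ..
    also have "\<dots> = (\<lambda>z. (if n = m then a m m else 0) * hom_poly m c z)"
    proof (cases "n = m")
      case True
      have "hom_poly n (a l) = (\<lambda>z. a m m * hom_monom m l z)" if "l \<le> m" for l
        using hom_poly_single[of l n "a m m"] a_eq[OF that] that True
        by (simp add: hom_poly_def fun_eq_iff)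
      then show ?thesis
        using True by (simp add: hom_poly_def sum_distrib_left mult_ac)
    next
      case False
      have "hom_poly n (a l) z = 0" if "l \<le> m" for l z
        using a_eq[OF that] False by (simp add: hom_poly_def)
      then show ?thesis
        using False by simp
    qed
    also have "\<dots> = lin_comb n b (\<lambda>i. if n = m \<and> i = k then a m m else 0)"
    proof (cases "n = m")
      case True
      then show ?thesis
        using lin_comb_single[of k n b "a m m"] k c by (simp add: b'_def)
    next
      case False
      then show ?thesis
        by (simp add: lin_comb_def)
    qed
    finally show ?thesis
      by (rule lin_comb_eqD[OF b(1) _ i])
  qed
  then show ?thesis
    by blast
qed

section \<open>Integration against the Haar measure\<close>

lemma normalized_haar_SU2_measurable:
  assumes "normalized_haar_SU2 \<mu>" "continuous_on SU2 h"
  shows "(h :: _ \<Rightarrow> complex) \<in> borel_measurable \<mu>"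
proof -
  have "sets \<mu> = sets (restrict_space borel SU2)"
    using assms(1) by (simp add: normalized_haar_SU2_def)
  then show ?thesis
    using borel_measurable_continuous_on_restrict[OF assms(2)] by (simp cong: measurable_cong_sets)
qed

lemma normalized_haar_SU2_integral_mult_left:
  fixes h :: "complex^2^2 \<Rightarrow> complex"
  assumes \<mu>: "normalized_haar_SU2 \<mu>" and g: "g \<in> SU2" and h: "h \<in> borel_measurable \<mu>"
  shows "(\<integral>u. h (g ** u) \<partial>\<mu>) = (\<integral>u. h u \<partial>\<mu>)"
proof -
  have sets: "sets \<mu> = sets (restrict_space borel SU2)" and space: "space \<mu> = SU2"
    and inv: "distr \<mu> \<mu> (\<lambda>u. g ** u) = \<mu>"
    using \<mu> g by (auto simp: normalized_haar_SU2_def)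
  have "continuous_on SU2 (\<lambda>u. g ** u)"
    unfolding matrix_matrix_mult_def
    by (intro continuous_on_vec_lambda continuous_on_sum continuous_on_mult continuous_on_const
        continuous_on_component continuous_on_id)
  then have "(\<lambda>u. g ** u) \<in> borel_measurable \<mu>"
    using borel_measurable_continuous_on_restrict sets by (simp cong: measurable_cong_sets)
  then have "(\<lambda>u. g ** u) \<in> \<mu> \<rightarrow>\<^sub>M restrict_space borel SU2"
    using SU2_mult[OF g] by (intro measurable_restrict_space2) (auto simp: space)
  then have "(\<lambda>u. g ** u) \<in> \<mu> \<rightarrow>\<^sub>M \<mu>"
    using sets by (simp cong: measurable_cong_sets)
  from integral_distr[OF this h] show ?thesis
    by (simp add: inv)
qed

section \<open>Orthogonality and Fourier coefficients\<close>

lemma integrable_of_integrable_square: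
  fixes f :: "'a \<Rightarrow> complex"
  assumes "finite_measure M" and f: "f \<in> borel_measurable M" and f2: "integrable M (\<lambda>u. (cmod (f u))\<^sup>2)"
  shows "integrable M f"
proof -
  interpret finite_measure M by fact
  have f_le: "norm (f u) \<le> norm (1 + (cmod (f u))\<^sup>2)" for u
    using self_le_power[of "cmod (f u)" 2] by (cases "1 \<le> cmod (f u)") (auto simp: add_increasing2)
  show ?thesis
    by (rule Bochner_Integration.integrable_bound[OF Bochner_Integration.integrable_add[OF integrable_const f2] f AE_I2[OF f_le]])
qed

lemma integrable_mult_bounded:
  fixes f g :: "'a \<Rightarrow> complex"
  assumes f: "integrable M f" and g: "g \<in> borel_measurable M" and B: "\<And>u. u \<in> space M \<Longrightarrow> cmod (g u) \<le> B"
  shows "integrable M (\<lambda>u. f u * g u)"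
proof (rule Bochner_Integration.integrable_bound)
  show "integrable M (\<lambda>u. B * norm (f u))"
    using f by simp
  show "(\<lambda>u. f u * g u) \<in> borel_measurable M"
    using f g by measurable
  show "AE u in M. norm (f u * g u) \<le> norm (B * norm (f u))"
  proof (rule AE_I2)
    fix u assume "u \<in> space M"
    from B[OF this] have "cmod (g u) \<le> \<bar>B\<bar>"
      by simp
    from mult_right_mono[OF this, of "norm (f u)"] show "norm (f u * g u) \<le> norm (B * norm (f u))"
      by (simp add: norm_mult mult.commute abs_mult)
  qed
qed

lemma borel_measurable_cnj [measurable (raw)]:
  "f \<in> borel_measurable M \<Longrightarrow> (\<lambda>u. cnj (f u)) \<in> borel_measurable M"
  by (rule measurable_compose[OF _ borel_measurable_continuous_onI]) (auto intro: continuous_intros)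

text \<open>Non-negativity of the squared L^2 distance from \<open>f\<close> to its projection,
  expanded. The finite measure and the uniform bound on the \<open>\<phi> i\<close> make all
  products integrable.\<close>

lemma bessel_inequality:
  fixes \<phi> :: "'i \<Rightarrow> 'a \<Rightarrow> complex"
  assumes M: "finite_measure M" and I: "finite I"
    and \<phi>: "\<And>i. i \<in> I \<Longrightarrow> \<phi> i \<in> borel_measurable M"
    and B: "\<And>i u. i \<in> I \<Longrightarrow> u \<in> space M \<Longrightarrow> cmod (\<phi> i u) \<le> B"
    and orth: "\<And>i j. i \<in> I \<Longrightarrow> j \<in> I \<Longrightarrow> (\<integral>u. \<phi> i u * cnj (\<phi> j u) \<partial>M) = (if i = j then 1 else 0)"
    and f: "f \<in> borel_measurable M" and f2: "integrable M (\<lambda>u. (cmod (f u))\<^sup>2)"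
  shows "(\<Sum>i\<in>I. (cmod (\<integral>u. f u * cnj (\<phi> i u) \<partial>M))\<^sup>2) \<le> (\<integral>u. (cmod (f u))\<^sup>2 \<partial>M)"
proof -
  interpret finite_measure M by fact
  define c where "c i = (\<integral>u. f u * cnj (\<phi> i u) \<partial>M)" for i
  have intf: "integrable M f"
    by (rule integrable_of_integrable_square[OF M f f2])
  have int1: "integrable M (\<lambda>u. f u * cnj (\<phi> i u))" if "i \<in> I" for i
    using \<phi>[OF that] B[OF that] by (intro integrable_mult_bounded[OF intf, of _ B]) auto
  have int2: "integrable M (\<lambda>u. cnj (f u) * \<phi> i u)" if "i \<in> I" for i
    using intf \<phi>[OF that] B[OF that] by (intro integrable_mult_bounded[of _ _ _ B]) auto
  have int3: "integrable M (\<lambda>u. \<phi> i u * cnj (\<phi> j u))" if "i \<in> I" "j \<in> I" for i j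
    using \<phi>[OF that(1)] \<phi>[OF that(2)] B[OF that(1)] B[OF that(2)]
    by (intro integrable_mult_bounded[of _ _ _ B] integrable_const_bound[of _ B]) auto
  have int4: "integrable M (\<lambda>u. complex_of_real ((cmod (f u))\<^sup>2))"
    using f2 by (rule integrable_of_real)
  have c': "(\<integral>u. cnj (f u) * \<phi> i u \<partial>M) = cnj (c i)" for i
    using Bochner_Integration.integral_cnj[of M "\<lambda>u. f u * cnj (\<phi> i u)"] by (simp add: c_def)
  have expand: "complex_of_real ((cmod (f u - (\<Sum>i\<in>I. c i * \<phi> i u)))\<^sup>2) = complex_of_real ((cmod (f u))\<^sup>2)
      - (\<Sum>i\<in>I. cnj (c i) * (f u * cnj (\<phi> i u))) - (\<Sum>i\<in>I. c i * (cnj (f u) * \<phi> i u))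
      + (\<Sum>i\<in>I. \<Sum>j\<in>I. c i * cnj (c j) * (\<phi> i u * cnj (\<phi> j u)))" for u
  proof -
    let ?S = "\<Sum>i\<in>I. c i * \<phi> i u"
    have "complex_of_real ((cmod (f u - ?S))\<^sup>2)
        = complex_of_real ((cmod (f u))\<^sup>2) - f u * cnj ?S - ?S * cnj (f u) + ?S * cnj ?S"
      unfolding complex_norm_square by (simp add: algebra_simps del: cnj_sum)
    also have "f u * cnj ?S = (\<Sum>i\<in>I. cnj (c i) * (f u * cnj (\<phi> i u)))"
      by (simp add: cnj_sum sum_distrib_left mult_ac)
    also have "?S * cnj (f u) = (\<Sum>i\<in>I. c i * (cnj (f u) * \<phi> i u))"
      by (simp add: sum_distrib_left mult_ac)
    also have "?S * cnj ?S = (\<Sum>i\<in>I. \<Sum>j\<in>I. c i * cnj (c j) * (\<phi> i u * cnj (\<phi> j u)))"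
      by (simp add: cnj_sum sum_product mult_ac)
    finally show ?thesis .
  qed
  have "complex_of_real (\<integral>u. (cmod (f u - (\<Sum>i\<in>I. c i * \<phi> i u)))\<^sup>2 \<partial>M)
      = (\<integral>u. complex_of_real ((cmod (f u - (\<Sum>i\<in>I. c i * \<phi> i u)))\<^sup>2) \<partial>M)"
    by (simp only: integral_complex_of_real)
  also have "\<dots> = (\<integral>u. complex_of_real ((cmod (f u))\<^sup>2) \<partial>M)
      - (\<Sum>i\<in>I. cnj (c i) * c i) - (\<Sum>i\<in>I. c i * cnj (c i))
      + (\<Sum>i\<in>I. \<Sum>j\<in>I. c i * cnj (c j) * (if i = j then 1 else 0))"
  proof -
    have i1: "integrable M (\<lambda>u. \<Sum>i\<in>I. cnj (c i) * (f u * cnj (\<phi> i u)))"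
      by (intro Bochner_Integration.integrable_sum integrable_mult_right int1)
    have i2: "integrable M (\<lambda>u. \<Sum>i\<in>I. c i * (cnj (f u) * \<phi> i u))"
      by (intro Bochner_Integration.integrable_sum integrable_mult_right int2)
    have i3: "integrable M (\<lambda>u. \<Sum>i\<in>I. \<Sum>j\<in>I. c i * cnj (c j) * (\<phi> i u * cnj (\<phi> j u)))"
      by (intro Bochner_Integration.integrable_sum integrable_mult_right int3)
    have e1: "(\<integral>u. (\<Sum>i\<in>I. cnj (c i) * (f u * cnj (\<phi> i u))) \<partial>M) = (\<Sum>i\<in>I. cnj (c i) * c i)"
      using int1 by (simp add: Bochner_Integration.integral_sum c_def)
    have e2: "(\<integral>u. (\<Sum>i\<in>I. c i * (cnj (f u) * \<phi> i u)) \<partial>M) = (\<Sum>i\<in>I. c i * cnj (c i))"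
      using int2 by (simp add: Bochner_Integration.integral_sum c')
    have e3: "(\<integral>u. (\<Sum>i\<in>I. \<Sum>j\<in>I. c i * cnj (c j) * (\<phi> i u * cnj (\<phi> j u))) \<partial>M)
      = (\<Sum>i\<in>I. \<Sum>j\<in>I. c i * cnj (c j) * (if i = j then 1 else 0))"
    proof -
      have "(\<integral>u. (\<Sum>i\<in>I. \<Sum>j\<in>I. c i * cnj (c j) * (\<phi> i u * cnj (\<phi> j u))) \<partial>M)
        = (\<Sum>i\<in>I. \<Sum>j\<in>I. (\<integral>u. c i * cnj (c j) * (\<phi> i u * cnj (\<phi> j u)) \<partial>M))"
        using int3 by (subst Bochner_Integration.integral_sum, force)
          (intro sum.cong refl Bochner_Integration.integral_sum, force)
      also have "\<dots> = (\<Sum>i\<in>I. \<Sum>j\<in>I. c i * cnj (c j) * (if i = j then 1 else 0))"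
        by (intro sum.cong refl) (simp add: orth)
      finally show ?thesis .
    qed
    show ?thesis
      unfolding expand
      by (simp only: Bochner_Integration.integral_add Bochner_Integration.integral_diff
          Bochner_Integration.integrable_diff int4 i1 i2 i3 e1 e2 e3)
  qed
  also have "\<dots> = complex_of_real ((\<integral>u. (cmod (f u))\<^sup>2 \<partial>M) - (\<Sum>i\<in>I. (cmod (c i))\<^sup>2))"
  proof -
    have "(\<Sum>i\<in>I. \<Sum>j\<in>I. c i * cnj (c j) * (if i = j then 1 else 0)) = (\<Sum>i\<in>I. c i * cnj (c i))"
      using I by (simp add: if_distrib cong: if_cong)
    moreover have "complex_of_real (\<Sum>i\<in>I. (cmod (c i))\<^sup>2) = (\<Sum>i\<in>I. c i * cnj (c i))"
      by (simp only: of_real_sum complex_norm_square)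
    ultimately show ?thesis
      unfolding integral_complex_of_real of_real_diff by (simp add: mult.commute)
  qed
  finally have "(\<integral>u. (cmod (f u - (\<Sum>i\<in>I. c i * \<phi> i u)))\<^sup>2 \<partial>M) = (\<integral>u. (cmod (f u))\<^sup>2 \<partial>M) - (\<Sum>i\<in>I. (cmod (c i))\<^sup>2)"
    by (simp only: of_real_eq_iff)
  moreover have "0 \<le> (\<integral>u. (cmod (f u - (\<Sum>i\<in>I. c i * \<phi> i u)))\<^sup>2 \<partial>M)"
    by (rule Bochner_Integration.integral_nonneg) simp
  ultimately show ?thesis
    by (simp add: c_def)
qed

text \<open>Minkowski's inequality for integrals, by duality: the squared norm of the vector of
  integrals is one integral of \<open>h\<close> against a pairing with that vector, and
  Cauchy-Schwarz applies at each point. \<open>B\<close> serves integrability, \<open>D\<close> the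
  estimate; the final division by the norm sets the case \<open>s = 0\<close> apart.\<close>

lemma L2_set_integral_le:
  fixes \<phi> :: "'i \<Rightarrow> 'a \<Rightarrow> complex"
  assumes h: "integrable M h"
    and \<phi>: "\<And>i. i \<in> I \<Longrightarrow> \<phi> i \<in> borel_measurable M"
    and B: "\<And>i u. i \<in> I \<Longrightarrow> u \<in> space M \<Longrightarrow> cmod (\<phi> i u) \<le> B"
    and D: "\<And>u. u \<in> space M \<Longrightarrow> L2_set (\<lambda>i. cmod (\<phi> i u)) I \<le> D"
    and D0: "0 \<le> D"
  shows "L2_set (\<lambda>i. cmod (\<integral>u. h u * cnj (\<phi> i u) \<partial>M)) I \<le> D * (\<integral>u. cmod (h u) \<partial>M)"
proof -
  define c where "c i = (\<integral>u. h u * cnj (\<phi> i u) \<partial>M)" for i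
  define s where "s = L2_set (\<lambda>i. cmod (c i)) I"
  have int: "integrable M (\<lambda>u. h u * cnj (\<phi> i u))" if "i \<in> I" for i
    using \<phi>[OF that] B[OF that] by (intro integrable_mult_bounded[OF h, of _ B]) auto
  have "complex_of_real (s\<^sup>2) = (\<Sum>i\<in>I. cnj (c i) * c i)"
    unfolding s_def L2_set_def
    by (simp add: sum_nonneg complex_norm_square mult.commute del: of_real_power)
  also have "\<dots> = (\<integral>u. (\<Sum>i\<in>I. cnj (c i) * (h u * cnj (\<phi> i u))) \<partial>M)"
    using int by (simp add: Bochner_Integration.integral_sum c_def)
  finally have eq: "complex_of_real (s\<^sup>2) = (\<integral>u. (\<Sum>i\<in>I. cnj (c i) * (h u * cnj (\<phi> i u))) \<partial>M)" .
  have s0: "0 \<le> s"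
    by (simp add: s_def)
  have "s\<^sup>2 = cmod (complex_of_real (s\<^sup>2))"
    unfolding norm_of_real by simp
  also have "\<dots> \<le> (\<integral>u. cmod (\<Sum>i\<in>I. cnj (c i) * (h u * cnj (\<phi> i u))) \<partial>M)"
    unfolding eq by (rule integral_norm_bound)
  also have "\<dots> \<le> (\<integral>u. s * D * cmod (h u) \<partial>M)"
  proof (rule integral_mono)
    show "integrable M (\<lambda>u. cmod (\<Sum>i\<in>I. cnj (c i) * (h u * cnj (\<phi> i u))))"
      using int by (intro integrable_norm Bochner_Integration.integrable_sum integrable_mult_right) auto
    show "integrable M (\<lambda>u. s * D * cmod (h u))"
      using h by simp
    fix u assume u: "u \<in> space M"
    have "cmod (\<Sum>i\<in>I. cnj (c i) * (h u * cnj (\<phi> i u))) \<le> (\<Sum>i\<in>I. cmod (cnj (c i) * (h u * cnj (\<phi> i u))))"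
      by (rule norm_sum)
    also have "\<dots> = (\<Sum>i\<in>I. \<bar>cmod (c i)\<bar> * \<bar>cmod (\<phi> i u)\<bar>) * cmod (h u)"
      by (simp add: norm_mult sum_distrib_left mult_ac)
    also have "\<dots> \<le> (s * L2_set (\<lambda>i. cmod (\<phi> i u)) I) * cmod (h u)"
      unfolding s_def by (intro mult_right_mono L2_set_mult_ineq) auto
    also have "\<dots> \<le> (s * D) * cmod (h u)"
      using D[OF u] s0 by (intro mult_right_mono mult_left_mono) auto
    finally show "cmod (\<Sum>i\<in>I. cnj (c i) * (h u * cnj (\<phi> i u))) \<le> s * D * cmod (h u)" .
  qed
  finally have "s * s \<le> s * (D * (\<integral>u. cmod (h u) \<partial>M))"
    by (simp add: power2_eq_square mult_ac)
  then have "s \<le> D * (\<integral>u. cmod (h u) \<partial>M)" if "s \<noteq> 0"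
    using that s0 by (subst (asm) mult_le_cancel_left_pos) auto
  moreover have "s \<le> D * (\<integral>u. cmod (h u) \<partial>M)" if "s = 0"
    using that D0 by simp
  ultimately show ?thesis
    unfolding s_def c_def by blast
qed

section \<open>Schur orthogonality relations\<close>

lemma integrable_SU2_unitary_rep:
  assumes \<mu>: "normalized_haar_SU2 \<mu>" and T: "SU2_unitary_rep n T" and T': "SU2_unitary_rep m T'"
    and "i \<le> n" "j \<le> n" "k \<le> m" "l \<le> m"
  shows "integrable \<mu> (\<lambda>u. T u $$ (i, j) * cnj (T' u $$ (k, l)))"
proof -
  interpret prob_space \<mu>
    using \<mu> by (simp add: normalized_haar_SU2_def)
  have space: "space \<mu> = SU2"
    using \<mu> by (simp add: normalized_haar_SU2_def)
  have [measurable]: "(\<lambda>u. T u $$ (i, j)) \<in> borel_measurable \<mu>" "(\<lambda>u. T' u $$ (k, l)) \<in> borel_measurable \<mu>"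
    using assms by (auto intro!: normalized_haar_SU2_measurable[OF \<mu>] continuous_on_SU2_unitary_rep)
  show ?thesis
    using SU2_unitary_rep_le_1[OF T _ assms(4,5)] SU2_unitary_rep_le_1[OF T' _ assms(6,7)]
    by (intro integrable_mult_bounded[of _ _ _ 1] integrable_const_bound[of _ 1] AE_I2) (auto simp: space)
qed

text \<open>With columns \<open>j\<close> and \<open>l\<close> fixed, the integrals over varying
  rows form a matrix X. Translating by g gives T(g) X T'(g)^* = X, so X intertwines, and Schur's
  lemma leaves a single scalar.\<close>

lemma SU2_rep_orthogonality_le:
  assumes \<mu>: "normalized_haar_SU2 \<mu>" and T: "SU2_unitary_rep n T" and T': "SU2_unitary_rep m T'"
    and le: "n \<le> m" and same: "n = m \<Longrightarrow> T = T'"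
    and ij: "i \<le> n" "j \<le> n" and kl: "k \<le> m" "l \<le> m"
  shows "(\<integral>u. T u $$ (i, j) * cnj (T' u $$ (k, l)) \<partial>\<mu>)
    = (if n = m \<and> i = k \<and> j = l then 1 / of_nat (n + 1) else 0)"
proof -
  interpret prob_space \<mu>
    using \<mu> by (simp add: normalized_haar_SU2_def)
  have space: "space \<mu> = SU2"
    using \<mu> by (simp add: normalized_haar_SU2_def)
  define X where "X i k = (\<integral>u. T u $$ (i, j) * cnj (T' u $$ (k, l)) \<partial>\<mu>)" for i k
  have int: "integrable \<mu> (\<lambda>u. T u $$ (a, j) * cnj (T' u $$ (b, l)))" if "a \<le> n" "b \<le> m" for a b
    using that ij kl by (intro integrable_SU2_unitary_rep[OF \<mu> T T'])
  have inv: "X i k = (\<Sum>a\<le>n. \<Sum>b\<le>m. T g $$ (i, a) * cnj (T' g $$ (k, b)) * X a b)"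
    if g: "g \<in> SU2" and i: "i \<le> n" and k: "k \<le> m" for g i k
  proof -
    have "X i k = (\<integral>u. T (g ** u) $$ (i, j) * cnj (T' (g ** u) $$ (k, l)) \<partial>\<mu>)"
      unfolding X_def
      by (rule normalized_haar_SU2_integral_mult_left[OF \<mu> g, symmetric])
        (use int[OF i k] in simp)
    also have "\<dots> = (\<integral>u. (\<Sum>a\<le>n. \<Sum>b\<le>m. T g $$ (i, a) * cnj (T' g $$ (k, b)) * (T u $$ (a, j) * cnj (T' u $$ (b, l)))) \<partial>\<mu>)"
    proof (rule Bochner_Integration.integral_cong)
      fix u assume "u \<in> space \<mu>"
      then have u: "u \<in> SU2"
        by (simp add: space)
      show "T (g ** u) $$ (i, j) * cnj (T' (g ** u) $$ (k, l))
        = (\<Sum>a\<le>n. \<Sum>b\<le>m. T g $$ (i, a) * cnj (T' g $$ (k, b)) * (T u $$ (a, j) * cnj (T' u $$ (b, l))))"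
        unfolding SU2_unitary_rep_mult[OF T g u i ij(2)] SU2_unitary_rep_mult[OF T' g u k kl(2)]
        by (simp add: cnj_sum sum_product mult_ac)
    qed simp
    also have "\<dots> = (\<Sum>a\<le>n. \<integral>u. (\<Sum>b\<le>m. T g $$ (i, a) * cnj (T' g $$ (k, b)) * (T u $$ (a, j) * cnj (T' u $$ (b, l)))) \<partial>\<mu>)"
      by (rule Bochner_Integration.integral_sum) (intro Bochner_Integration.integrable_sum integrable_mult_right int; simp)
    also have "\<dots> = (\<Sum>a\<le>n. \<Sum>b\<le>m. \<integral>u. T g $$ (i, a) * cnj (T' g $$ (k, b)) * (T u $$ (a, j) * cnj (T' u $$ (b, l))) \<partial>\<mu>)"
      by (intro sum.cong refl Bochner_Integration.integral_sum integrable_mult_right int; simp)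
    also have "\<dots> = (\<Sum>a\<le>n. \<Sum>b\<le>m. T g $$ (i, a) * cnj (T' g $$ (k, b)) * X a b)"
      by (simp add: X_def)
    finally show ?thesis .
  qed
  have "\<exists>e. \<forall>i\<le>n. \<forall>k\<le>m. X i k = (if n = m \<and> i = k then e else 0)"
  proof (rule SU2_rep_schur[OF T T' le same])
    fix g i c assume g: "g \<in> SU2" and i: "i \<le> n" and c: "c \<le> m"
    \<comment> \<open>Orthonormality of the columns of \<open>T' g\<close> moves its adjoint to the
      other side of the invariance identity.\<close>
    have "(\<Sum>k\<le>m. X i k * T' g $$ (k, c))
      = (\<Sum>k\<le>m. \<Sum>a\<le>n. \<Sum>b\<le>m. T g $$ (i, a) * X a b * (T' g $$ (k, c) * cnj (T' g $$ (k, b))))"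
      by (intro sum.cong refl) (simp add: inv[OF g i] sum_distrib_left mult_ac)
    also have "\<dots> = (\<Sum>a\<le>n. \<Sum>k\<le>m. \<Sum>b\<le>m. T g $$ (i, a) * X a b * (T' g $$ (k, c) * cnj (T' g $$ (k, b))))"
      by (rule sum.swap)
    also have "\<dots> = (\<Sum>a\<le>n. \<Sum>b\<le>m. \<Sum>k\<le>m. T g $$ (i, a) * X a b * (T' g $$ (k, c) * cnj (T' g $$ (k, b))))"
      by (intro sum.cong refl sum.swap)
    also have "\<dots> = (\<Sum>a\<le>n. \<Sum>b\<le>m. T g $$ (i, a) * X a b * (if c = b then 1 else 0))"
      by (intro sum.cong refl) (simp add: sum_distrib_left[symmetric] SU2_unitary_rep_cols[OF T' g c])
    also have "\<dots> = (\<Sum>a\<le>n. T g $$ (i, a) * X a c)"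
      using c by (simp add: if_distrib cong: if_cong)
    finally show "(\<Sum>k\<le>m. X i k * T' g $$ (k, c)) = (\<Sum>a\<le>n. T g $$ (i, a) * X a c)" .
  qed
  then obtain e where e: "\<And>i k. i \<le> n \<Longrightarrow> k \<le> m \<Longrightarrow> X i k = (if n = m \<and> i = k then e else 0)"
    by blast
  \<comment> \<open>The trace of \<open>X\<close> is (n + 1) times \<open>e\<close>; it is also the
    integral of the inner product of columns \<open>j\<close> and \<open>l\<close> of one unitary
    matrix.\<close>
  have "e = (if j = l then 1 / of_nat (n + 1) else 0)" if "n = m"
  proof -
    have "of_nat (n + 1) * e = (\<Sum>i\<le>n. X i i)"
      using e that by simp
    also have "\<dots> = (\<integral>u. (\<Sum>i\<le>n. T u $$ (i, j) * cnj (T' u $$ (i, l))) \<partial>\<mu>)"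
      unfolding X_def using int that by (intro Bochner_Integration.integral_sum[symmetric]) auto
    also have "\<dots> = (\<integral>u. (if j = l then 1 else 0) \<partial>\<mu>)"
      using SU2_unitary_rep_cols[OF T _ ij(2)] kl that same
      by (intro Bochner_Integration.integral_cong) (auto simp: space)
    also have "\<dots> = (if j = l then 1 else 0)"
      by (simp add: prob_space)
    finally have "of_nat (n + 1) * e = (if j = l then 1 else 0)" .
    moreover have "of_nat (n + 1) \<noteq> (0 :: complex)"
      by (simp only: of_nat_eq_0_iff add_is_0 one_neq_zero simp_thms not_False_eq_True)
    ultimately have "e = (if j = l then 1 else 0) / of_nat (n + 1)"
      by (metis nonzero_mult_div_cancel_left)
    then show ?thesis
      by simp
  qed
  then show ?thesis
    using e[OF ij(1) kl(1)] by (simp add: X_def)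
qed

text \<open>Complex conjugation exchanges the two representations, which removes the ordering of the
  degrees.\<close>

lemma SU2_rep_orthogonality:
  assumes \<mu>: "normalized_haar_SU2 \<mu>" and t: "\<And>n. SU2_unitary_rep n (t n)"
    and "i \<le> n" "j \<le> n" "k \<le> m" "l \<le> m"
  shows "(\<integral>u. t n u $$ (i, j) * cnj (t m u $$ (k, l)) \<partial>\<mu>)
    = (if n = m \<and> i = k \<and> j = l then 1 / of_nat (n + 1) else 0)"
proof (cases "n \<le> m")
  case True
  then show ?thesis
    using assms by (intro SU2_rep_orthogonality_le[OF \<mu> t t]) auto
next
  case False
  have "(\<integral>u. t n u $$ (i, j) * cnj (t m u $$ (k, l)) \<partial>\<mu>)
      = cnj (\<integral>u. t m u $$ (k, l) * cnj (t n u $$ (i, j)) \<partial>\<mu>)"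
    by (subst Bochner_Integration.integral_cnj[symmetric]) (simp add: mult.commute)
  also have "(\<integral>u. t m u $$ (k, l) * cnj (t n u $$ (i, j)) \<partial>\<mu>) = 0"
    using assms False by (subst SU2_rep_orthogonality_le[OF \<mu> t t]) auto
  finally show ?thesis
    using False by simp
qed

lemma hs_norm_eq_L2_set:
  assumes "M \<in> carrier_mat (n + 1) (n + 1)"
  shows "hs_norm M = L2_set (\<lambda>a. cmod (M $$ a)) ({..n} \<times> {..n})"
proof -
  have "mat_trace (M * mat_adjoint M) = (\<Sum>i\<le>n. (M * mat_adjoint M) $$ (i, i))"
    using assms by (simp add: mat_trace_def lessThan_Suc_atMost)
  also have "\<dots> = (\<Sum>i\<le>n. \<Sum>k\<le>n. M $$ (i, k) * mat_adjoint M $$ (k, i))"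
    by (intro sum.cong refl mat_mult_index_sum[OF assms mat_adjoint_carrier[OF assms]]) auto
  also have "\<dots> = (\<Sum>i\<le>n. \<Sum>k\<le>n. complex_of_real ((cmod (M $$ (i, k)))\<^sup>2))"
    by (intro sum.cong refl) (simp add: mat_adjoint_index[OF assms] complex_norm_square del: of_real_power)
  also have "\<dots> = complex_of_real (\<Sum>a\<in>{..n} \<times> {..n}. (cmod (M $$ a))\<^sup>2)"
    by (simp add: sum.cartesian_product)
  finally show ?thesis
    by (simp add: hs_norm_def L2_set_def)
qed

lemma fourier_coeff_carrier: "fourier_coeff \<mu> t f n \<in> carrier_mat (n + 1) (n + 1)"
  by (simp add: fourier_coeff_def)

text \<open>The adjoint conjugates and swaps the indices, hence the pair
  \<open>(snd a, fst a)\<close>.\<close>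

lemma fourier_coeff_index:
  assumes \<mu>: "normalized_haar_SU2 \<mu>" and t: "SU2_unitary_rep n (t n)" and a: "a \<in> {..n} \<times> {..n}"
  shows "fourier_coeff \<mu> t f n $$ a = (\<integral>u. f u * cnj (t n u $$ (snd a, fst a)) \<partial>\<mu>)"
proof -
  have "space \<mu> = SU2"
    using \<mu> by (simp add: normalized_haar_SU2_def)
  then have "(\<integral>u. f u * mat_adjoint (t n u) $$ a \<partial>\<mu>) = (\<integral>u. f u * cnj (t n u $$ (snd a, fst a)) \<partial>\<mu>)"
    using a by (intro Bochner_Integration.integral_cong)
      (auto simp: mat_adjoint_index[OF SU2_unitary_rep_carrier[OF t]])
  then show ?thesis
    using a by (auto simp: fourier_coeff_def)
qed

lemma hs_norm_fourier_coeff: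
  assumes "normalized_haar_SU2 \<mu>" "SU2_unitary_rep n (t n)"
  shows "hs_norm (fourier_coeff \<mu> t f n)
    = L2_set (\<lambda>a. cmod (\<integral>u. f u * cnj (t n u $$ (snd a, fst a)) \<partial>\<mu>)) ({..n} \<times> {..n})"
  unfolding hs_norm_eq_L2_set[OF fourier_coeff_carrier]
  by (intro L2_set_cong refl) (simp add: fourier_coeff_index[of \<mu> n t, OF assms])

lemma hs_norm_fourier_coeff_nonneg:
  "normalized_haar_SU2 \<mu> \<Longrightarrow> SU2_unitary_rep n (t n) \<Longrightarrow> 0 \<le> hs_norm (fourier_coeff \<mu> t f n)"
  by (simp add: hs_norm_fourier_coeff)

context
  fixes \<mu> :: "(complex^2^2) measure" and t :: "nat \<Rightarrow> complex^2^2 \<Rightarrow> complex mat"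
  assumes \<mu>: "normalized_haar_SU2 \<mu>" and t: "\<And>n. SU2_unitary_rep n (t n)"
begin

lemma space_eq_SU2: "space \<mu> = SU2"
  using \<mu> by (simp add: normalized_haar_SU2_def)

lemma prob_space_haar: "prob_space \<mu>"
  using \<mu> by (simp add: normalized_haar_SU2_def)

lemma rep_measurable: "i \<le> n \<Longrightarrow> j \<le> n \<Longrightarrow> (\<lambda>u. t n u $$ (i, j)) \<in> borel_measurable \<mu>"
  by (intro normalized_haar_SU2_measurable[OF \<mu>] continuous_on_SU2_unitary_rep[OF t])

text \<open>The matrix entries scaled by \<open>sqrt (real (n + 1))\<close> are orthonormal over all
  degrees in \<open>S\<close> at once; this scaling is the source of the weight
  \<open>real (n + 1)\<close>.\<close>

lemma fourier_coeff_bessel: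
  assumes S: "finite S" and f: "f \<in> borel_measurable \<mu>" and f2: "integrable \<mu> (\<lambda>u. (cmod (f u))\<^sup>2)"
  shows "(\<Sum>n\<in>S. real (n + 1) * (hs_norm (fourier_coeff \<mu> t f n))\<^sup>2) \<le> (\<integral>u. (cmod (f u))\<^sup>2 \<partial>\<mu>)"
proof -
  interpret prob_space \<mu>
    by (rule prob_space_haar)
  define I where "I = Sigma S (\<lambda>n. {..n} \<times> {..n})"
  define \<phi> where "\<phi> = (\<lambda>(n, a) u. complex_of_real (sqrt (real (n + 1))) * t n u $$ (snd a, fst a))"
  \<comment> \<open>A bound common to all degrees in \<open>S\<close>: unitary entries are at most 1
    in modulus, and the sum dominates each scaling factor.\<close>
  define N where "N = (\<Sum>n\<in>S. sqrt (real (n + 1)))"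
  have "(\<Sum>i\<in>I. (cmod (\<integral>u. f u * cnj (\<phi> i u) \<partial>\<mu>))\<^sup>2) \<le> (\<integral>u. (cmod (f u))\<^sup>2 \<partial>\<mu>)"
  proof (rule bessel_inequality[OF finite_measure_axioms _ _ _ _ f f2])
    show "finite I"
      using S by (simp add: I_def)
    show "\<phi> i \<in> borel_measurable \<mu>" if "i \<in> I" for i
      using that rep_measurable by (auto simp: I_def \<phi>_def)
    show "cmod (\<phi> i u) \<le> N" if "i \<in> I" "u \<in> space \<mu>" for i u
    proof -
      obtain n a b where i: "i = (n, a, b)" "n \<in> S" "a \<le> n" "b \<le> n"
        using \<open>i \<in> I\<close> by (auto simp: I_def)
      have "cmod (\<phi> i u) = sqrt (real (n + 1)) * cmod (t n u $$ (b, a))"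
        by (simp add: \<phi>_def i norm_mult del: of_nat_Suc of_nat_add)
      also have "\<dots> \<le> sqrt (real (n + 1)) * 1"
        using SU2_unitary_rep_le_1[OF t, of u b n a] that i by (intro mult_left_mono) (auto simp: space_eq_SU2)
      also have "\<dots> \<le> N"
        unfolding N_def mult_1_right using S i by (intro member_le_sum) auto
      finally show ?thesis .
    qed
    show "(\<integral>u. \<phi> i u * cnj (\<phi> j u) \<partial>\<mu>) = (if i = j then 1 else 0)" if "i \<in> I" "j \<in> I" for i j
    proof -
      obtain n a b where i: "i = (n, a, b)" "n \<in> S" "a \<le> n" "b \<le> n"
        using \<open>i \<in> I\<close> by (auto simp: I_def)
      obtain m c d where j: "j = (m, c, d)" "m \<in> S" "c \<le> m" "d \<le> m"
        using \<open>j \<in> I\<close> by (auto simp: I_def)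
      have "(\<integral>u. \<phi> i u * cnj (\<phi> j u) \<partial>\<mu>) = (\<integral>u. complex_of_real (sqrt (real (n + 1)) * sqrt (real (m + 1)))
        * (t n u $$ (b, a) * cnj (t m u $$ (d, c))) \<partial>\<mu>)"
        by (simp add: \<phi>_def i j mult_ac)
      also have "\<dots> = complex_of_real (sqrt (real (n + 1)) * sqrt (real (m + 1)))
        * (\<integral>u. t n u $$ (b, a) * cnj (t m u $$ (d, c)) \<partial>\<mu>)"
        by simp
      also have "\<dots> = (if i = j then 1 else 0)"
      proof (cases "i = j")
        case True
        then have "complex_of_real (sqrt (real (n + 1)) * sqrt (real (m + 1))) = of_nat (n + 1)"
          using i j by simp
        moreover have "of_nat (n + 1) \<noteq> (0 :: complex)"
          by (simp only: of_nat_eq_0_iff add_is_0 one_neq_zero simp_thms not_False_eq_True)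
        moreover have "(\<integral>u. t n u $$ (b, a) * cnj (t m u $$ (d, c)) \<partial>\<mu>) = 1 / of_nat (n + 1)"
          using True i j by (subst SU2_rep_orthogonality[OF \<mu> t]) auto
        ultimately show ?thesis
          using True by (simp del: of_nat_add of_nat_Suc)
      next
        case False
        then show ?thesis
          using i j by (subst SU2_rep_orthogonality[OF \<mu> t]) auto
      qed
      finally show ?thesis .
    qed
  qed
  also have "(\<Sum>i\<in>I. (cmod (\<integral>u. f u * cnj (\<phi> i u) \<partial>\<mu>))\<^sup>2)
    = (\<Sum>n\<in>S. \<Sum>a\<in>{..n} \<times> {..n}. (cmod (\<integral>u. f u * cnj (\<phi> (n, a) u) \<partial>\<mu>))\<^sup>2)"
    unfolding I_def using S by (subst sum.Sigma) (auto simp: split_def)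
  also have "\<dots> = (\<Sum>n\<in>S. real (n + 1) * (hs_norm (fourier_coeff \<mu> t f n))\<^sup>2)"
  proof (intro sum.cong refl)
    fix n
    have "(cmod (\<integral>u. f u * cnj (\<phi> (n, a) u) \<partial>\<mu>))\<^sup>2
      = real (n + 1) * (cmod (\<integral>u. f u * cnj (t n u $$ (snd a, fst a)) \<partial>\<mu>))\<^sup>2" for a
    proof -
      have "(\<integral>u. f u * cnj (\<phi> (n, a) u) \<partial>\<mu>)
        = (\<integral>u. complex_of_real (sqrt (real (n + 1))) * (f u * cnj (t n u $$ (snd a, fst a))) \<partial>\<mu>)"
        by (simp add: \<phi>_def mult_ac)
      also have "\<dots> = complex_of_real (sqrt (real (n + 1))) * (\<integral>u. f u * cnj (t n u $$ (snd a, fst a)) \<partial>\<mu>)"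
        by simp
      finally show ?thesis
        by (simp add: norm_mult power_mult_distrib del: of_nat_add of_nat_Suc)
    qed
    then show "(\<Sum>a\<in>{..n} \<times> {..n}. (cmod (\<integral>u. f u * cnj (\<phi> (n, a) u) \<partial>\<mu>))\<^sup>2)
      = real (n + 1) * (hs_norm (fourier_coeff \<mu> t f n))\<^sup>2"
      by (simp add: hs_norm_fourier_coeff[OF \<mu> t] L2_set_def sum_nonneg sum_distrib_left)
  qed
  finally show ?thesis .
qed

text \<open>The factor is the Hilbert-Schmidt norm of \<open>t n u\<close>, the same for every
  \<open>u\<close>, since its \<open>n + 1\<close> columns are unit vectors.\<close>

lemma fourier_coeff_L1_bound:
  assumes h: "integrable \<mu> h"
  shows "hs_norm (fourier_coeff \<mu> t h n) \<le> sqrt (real (n + 1)) * (\<integral>u. cmod (h u) \<partial>\<mu>)"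
  unfolding hs_norm_fourier_coeff[OF \<mu> t]
proof (rule L2_set_integral_le[OF h])
  fix u assume "u \<in> space \<mu>"
  then have u: "u \<in> SU2"
    by (simp add: space_eq_SU2)
  have "complex_of_real (\<Sum>a\<in>{..n} \<times> {..n}. (cmod (t n u $$ (snd a, fst a)))\<^sup>2)
    = (\<Sum>j\<le>n. \<Sum>i\<le>n. t n u $$ (i, j) * cnj (t n u $$ (i, j)))"
    by (simp only: of_real_sum complex_norm_square sum.cartesian_product split_def)
  also have "\<dots> = (\<Sum>j\<le>n. 1)"
    by (intro sum.cong refl) (simp add: SU2_unitary_rep_cols[OF t u])
  also have "\<dots> = complex_of_real (real (n + 1))"
    by simp
  finally have "(\<Sum>a\<in>{..n} \<times> {..n}. (cmod (t n u $$ (snd a, fst a)))\<^sup>2) = real (n + 1)"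
    by (simp only: of_real_eq_iff)
  then show "L2_set (\<lambda>a. cmod (t n u $$ (snd a, fst a))) ({..n} \<times> {..n}) \<le> sqrt (real (n + 1))"
    by (simp add: L2_set_def)
qed (auto intro: rep_measurable SU2_unitary_rep_le_1[OF t] simp: space_eq_SU2)

lemma fourier_coeff_triangle:
  assumes g: "integrable \<mu> g" and h: "integrable \<mu> h"
  shows "hs_norm (fourier_coeff \<mu> t (\<lambda>u. g u + h u) n)
    \<le> hs_norm (fourier_coeff \<mu> t g n) + hs_norm (fourier_coeff \<mu> t h n)"
proof -
  let ?c = "\<lambda>f a. \<integral>u. f u * cnj (t n u $$ (snd a, fst a)) \<partial>\<mu>"
  have int: "integrable \<mu> (\<lambda>u. f u * cnj (t n u $$ (snd a, fst a)))"
    if f: "integrable \<mu> f" and a: "a \<in> {..n} \<times> {..n}" for f a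
    using a by (intro integrable_mult_bounded[OF f, of _ 1] borel_measurable_cnj rep_measurable)
      (auto intro: SU2_unitary_rep_le_1[OF t] simp: space_eq_SU2)
  have "L2_set (\<lambda>a. cmod (?c (\<lambda>u. g u + h u) a)) ({..n} \<times> {..n})
      \<le> L2_set (\<lambda>a. cmod (?c g a) + cmod (?c h a)) ({..n} \<times> {..n})"
  proof (rule L2_set_mono)
    fix a assume a: "a \<in> {..n} \<times> {..n}"
    have "?c (\<lambda>u. g u + h u) a = ?c g a + ?c h a"
      using int[OF g a] int[OF h a] by (simp add: distrib_right)
    then show "cmod (?c (\<lambda>u. g u + h u) a) \<le> cmod (?c g a) + cmod (?c h a)"
      by (simp add: norm_triangle_ineq)
  qed simp
  also have "\<dots> \<le> L2_set (\<lambda>a. cmod (?c g a)) ({..n} \<times> {..n}) + L2_set (\<lambda>a. cmod (?c h a)) ({..n} \<times> {..n})"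
    by (rule L2_set_triangle_ineq)
  finally show ?thesis
    by (simp add: hs_norm_fourier_coeff[OF \<mu> t])
qed

end

section \<open>Paley's inequality\<close>

lemma l2_norm_eq_L2_set: "l2_norm v = L2_set (\<lambda>i. cmod (vec_index v i)) {..<dim_vec v}"
  by (simp add: l2_norm_def L2_set_def)

text \<open>A real supremum bounds its members only over a bounded set, so the image of the unit
  ball is first bounded by the sum of the moduli of all entries; the zero vector then gives the
  claim.\<close>

lemma op_norm_nonneg: "0 \<le> op_norm (M :: complex mat)"
proof -
  let ?A = "{v \<in> carrier_vec (dim_col M). l2_norm v \<le> 1}"
  have le: "l2_norm (M *\<^sub>v v) \<le> (\<Sum>i<dim_row M. \<Sum>j<dim_col M. cmod (M $$ (i, j)))" if v: "v \<in> ?A" for v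
  proof -
    have v1: "cmod (vec_index v j) \<le> 1" if "j < dim_col M" for j
    proof -
      have "cmod (vec_index v j) \<le> L2_set (\<lambda>i. cmod (vec_index v i)) {..<dim_vec v}"
        using v that by (intro member_le_L2_set) auto
      then show ?thesis
        using v by (simp add: l2_norm_eq_L2_set)
    qed
    have "l2_norm (M *\<^sub>v v) \<le> (\<Sum>i<dim_row M. cmod (vec_index (M *\<^sub>v v) i))"
      unfolding l2_norm_eq_L2_set dim_mult_mat_vec by (rule L2_set_le_sum) simp
    also have "\<dots> \<le> (\<Sum>i<dim_row M. \<Sum>j<dim_col M. cmod (M $$ (i, j)))"
    proof (intro sum_mono)
      fix i assume i: "i \<in> {..<dim_row M}"
      have "vec_index (M *\<^sub>v v) i = (\<Sum>j<dim_col M. M $$ (i, j) * vec_index v j)"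
        using i v by (auto simp: scalar_prod_def atLeast0LessThan intro!: sum.cong)
      also have "cmod \<dots> \<le> (\<Sum>j<dim_col M. cmod (M $$ (i, j) * vec_index v j))"
        by (rule norm_sum)
      also have "\<dots> \<le> (\<Sum>j<dim_col M. cmod (M $$ (i, j)))"
        by (intro sum_mono) (simp add: norm_mult mult_left_le v1)
      finally show "cmod (vec_index (M *\<^sub>v v) i) \<le> (\<Sum>j<dim_col M. cmod (M $$ (i, j)))" .
    qed
    finally show ?thesis .
  qed
  have "0 \<le> l2_norm (M *\<^sub>v 0\<^sub>v (dim_col M))"
    by (simp add: l2_norm_def sum_nonneg)
  also have "\<dots> \<le> op_norm M"
    unfolding op_norm_def
  proof (rule cSUP_upper)
    show "0\<^sub>v (dim_col M) \<in> ?A"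
      by (simp add: l2_norm_def)
    show "bdd_above ((\<lambda>v. l2_norm (M *\<^sub>v v)) ` ?A)"
      using le by (intro bdd_aboveI2)
  qed
  finally show ?thesis .
qed

text \<open>Passes from the extended supremum to the real inequality that the interpolation uses: a
  finite part of a level set lies below the infinite sum, and finiteness makes
  \<open>enn2real\<close> faithful.\<close>

lemma K_const_level_bound:
  assumes "K_const \<sigma> < \<infinity>" "finite S" "0 < s"
  shows "s * (\<Sum>n\<in>{n \<in> S. s \<le> op_norm (\<sigma> n)}. (real (n + 1))\<^sup>2) \<le> enn2real (K_const \<sigma>)"
proof -
  let ?S = "{n \<in> S. s \<le> op_norm (\<sigma> n)}"
  have "ennreal (s * (\<Sum>n\<in>?S. (real (n + 1))\<^sup>2)) = ennreal s * (\<Sum>n\<in>?S. ennreal ((real (n + 1))\<^sup>2))"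
    using assms(3) by (simp add: ennreal_mult'[symmetric] sum_ennreal)
  also have "\<dots> \<le> ennreal s * (\<Sum>\<^sub>\<infinity>n\<in>{n. s \<le> op_norm (\<sigma> n)}. ennreal ((real (n + 1))\<^sup>2))"
    using assms(2) by (intro mult_left_mono, subst nonneg_infsum_complete) (auto intro!: SUP_upper)
  also have "\<dots> \<le> K_const \<sigma>"
    unfolding K_const_def using assms(3)
    by (intro SUP_upper[of s "{0<..}" "\<lambda>s. ennreal s * (\<Sum>\<^sub>\<infinity>n\<in>{n. s \<le> op_norm (\<sigma> n)}. ennreal ((real (n + 1))\<^sup>2))"]) simp
  also have "\<dots> = ennreal (enn2real (K_const \<sigma>))"
    using assms(1) by simp
  finally show ?thesis
    by (subst (asm) ennreal_le_iff) auto
qed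

text \<open>For non-negative terms the infinite sum is the supremum of the finite ones, so bounds
  uniform in \<open>S\<close> suffice.\<close>

lemma infsum_ennreal_le:
  fixes f :: "'a \<Rightarrow> real"
  assumes "\<And>x. 0 \<le> f x" "\<And>S. finite S \<Longrightarrow> sum f S \<le> B"
  shows "(\<Sum>\<^sub>\<infinity>x. ennreal (f x)) \<le> ennreal B"
  using assms by (subst nonneg_infsum_complete) (auto intro!: SUP_least ennreal_leI simp: sum_ennreal)

text \<open>The exponent equals 2 - p/2: the 2 is the factor \<open>d\<^sup>2\<close> in the mass of
  an index, and -p/2 normalizes the coefficient by \<open>sqrt d\<close>.\<close>

lemma paley_weight:
  fixes d h \<tau> p :: real
  assumes "0 < d" "0 \<le> h" "0 < p"
  shows "d powr (p * (2 / p - 1 / 2)) * h powr p = d\<^sup>2 * (h / sqrt d) powr p"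
proof -
  have "p * (2 / p - 1 / 2) = 2 - p / 2"
    using assms by (simp add: field_simps)
  moreover have "sqrt d powr p = d powr (p / 2)"
    using assms by (simp add: powr_half_sqrt[symmetric] powr_powr)
  ultimately show ?thesis
    using assms by (simp add: powr_divide powr_diff powr_numeral)
qed

lemma Lp_norm_powr: "0 < p \<Longrightarrow> Lp_norm \<mu> p f powr p = (\<integral>u. cmod (f u) powr p \<partial>\<mu>)"
  by (simp add: Lp_norm_def powr_powr)


context
  fixes \<mu> :: "(complex^2^2) measure" and t :: "nat \<Rightarrow> complex^2^2 \<Rightarrow> complex mat"
    and \<sigma> :: "nat \<Rightarrow> complex mat" and f :: "complex^2^2 \<Rightarrow> complex" and p :: real
  assumes \<mu>: "normalized_haar_SU2 \<mu>" and t: "\<And>n. SU2_unitary_rep n (t n)" and f: "in_Lp \<mu> p f"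
begin

text \<open>At p = 2 the dimension exponent is 1 and \<open>pow0\<close> returns 1 for the exponent
  0, even at base 0; so \<open>\<sigma>\<close> disappears from both sides and Bessel's inequality
  remains.\<close>

lemma paley_L2:
  assumes "p = 2" "finite S"
  shows "(\<Sum>n\<in>S. real (n + 1) powr (p * (2 / p - 1 / 2)) * hs_norm (fourier_coeff \<mu> t f n) powr p
      * pow0 (op_norm (\<sigma> n)) (2 - p))
    \<le> 1 * pow0 (enn2real (K_const \<sigma>)) (2 - p) * Lp_norm \<mu> p f powr p"
proof -
  have sq: "x powr 2 = x\<^sup>2" if "0 \<le> x" for x :: real
    using that by simp
  have "(\<Sum>n\<in>S. real (n + 1) powr (p * (2 / p - 1 / 2)) * hs_norm (fourier_coeff \<mu> t f n) powr p
      * pow0 (op_norm (\<sigma> n)) (2 - p)) = (\<Sum>n\<in>S. real (n + 1) * (hs_norm (fourier_coeff \<mu> t f n))\<^sup>2)"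
    using hs_norm_fourier_coeff_nonneg[where t = t, OF \<mu> t]
    by (intro sum.cong refl) (simp add: assms pow0_def sq)
  also have "\<dots> \<le> (\<integral>u. (cmod (f u))\<^sup>2 \<partial>\<mu>)"
    using f assms by (intro fourier_coeff_bessel[OF \<mu> t]) (auto simp: in_Lp_def sq)
  also have "\<dots> = 1 * pow0 (enn2real (K_const \<sigma>)) (2 - p) * Lp_norm \<mu> p f powr p"
    using Lp_norm_powr[of p \<mu> f] by (simp add: assms pow0_def sq)
  finally show ?thesis .
qed

lemma paley_interpolated:
  assumes p: "1 < p" "p < 2" and K: "K_const \<sigma> < \<infinity>" and S: "finite S"
  shows "(\<Sum>n\<in>S. real (n + 1) powr (p * (2 / p - 1 / 2)) * hs_norm (fourier_coeff \<mu> t f n) powr p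
      * pow0 (op_norm (\<sigma> n)) (2 - p))
    \<le> (4 * p / (2 - p) + 4 * p / (p - 1)) * pow0 (enn2real (K_const \<sigma>)) (2 - p) * Lp_norm \<mu> p f powr p"
proof -
  interpret prob_space \<mu>
    by (rule prob_space_haar[OF \<mu> t])
  \<comment> \<open>Scaled so that the L^1 bound has constant 1; Bessel's inequality then carries
    the weight \<open>(real (n + 1))\<^sup>2\<close>, the same as in \<open>K_const\<close>.\<close>
  define F where "F g n = hs_norm (fourier_coeff \<mu> t g n) / sqrt (real (n + 1))" for g n
  note hs0 = hs_norm_fourier_coeff_nonneg[where t = t, OF \<mu> t]
  have sum_eq: "(\<Sum>n\<in>S. real (n + 1) powr (p * (2 / p - 1 / 2)) * hs_norm (fourier_coeff \<mu> t f n) powr p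
      * pow0 (op_norm (\<sigma> n)) (2 - p))
    = (\<Sum>n\<in>S. (real (n + 1))\<^sup>2 * F f n powr p * op_norm (\<sigma> n) powr (2 - p))"
  proof (intro sum.cong refl)
    fix n
    have "real (n + 1) powr (p * (2 / p - 1 / 2)) * hs_norm (fourier_coeff \<mu> t f n) powr p
      = (real (n + 1))\<^sup>2 * F f n powr p"
      unfolding F_def using p hs0 by (intro paley_weight) auto
    then show "real (n + 1) powr (p * (2 / p - 1 / 2)) * hs_norm (fourier_coeff \<mu> t f n) powr p
        * pow0 (op_norm (\<sigma> n)) (2 - p) = (real (n + 1))\<^sup>2 * F f n powr p * op_norm (\<sigma> n) powr (2 - p)"
      using p by (simp add: pow0_def)
  qed
  show ?thesis
  \<comment> \<open>Truncation at height \<open>K * y\<close> requires \<open>K > 0\<close>. If the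
    constant is 0, the level bound for the singleton \<open>{n}\<close> at
    \<open>s = op_norm (\<sigma> n)\<close> forces every operator norm to vanish, and with it every
    summand.\<close>
  proof (cases "enn2real (K_const \<sigma>) = 0")
    case True
    have "op_norm (\<sigma> n) = 0" for n
    proof (rule ccontr)
      assume "op_norm (\<sigma> n) \<noteq> 0"
      then have pos: "0 < op_norm (\<sigma> n)"
        using op_norm_nonneg[of "\<sigma> n"] by simp
      have "{m \<in> {n}. op_norm (\<sigma> n) \<le> op_norm (\<sigma> m)} = {n}"
        by auto
      then have "op_norm (\<sigma> n) * (real (n + 1))\<^sup>2 \<le> 0"
        using K_const_level_bound[OF K _ pos, of "{n}"] True by simp
      moreover have "0 < op_norm (\<sigma> n) * (real (n + 1))\<^sup>2"
        using pos by (intro mult_pos_pos zero_less_power) auto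
      ultimately show False
        by simp
    qed
    then show ?thesis
      unfolding sum_eq using p True by (simp add: pow0_def)
  next
    case False
    then have K0: "0 < enn2real (K_const \<sigma>)"
      by (simp add: less_le)
    have "(\<Sum>n\<in>S. (real (n + 1))\<^sup>2 * F f n powr p * op_norm (\<sigma> n) powr (2 - p))
      \<le> (4 * p / (2 - p) + 4 * p / (p - 1)) * enn2real (K_const \<sigma>) powr (2 - p) * (\<integral>u. cmod (f u) powr p \<partial>\<mu>)"
    proof (rule marcinkiewicz_weighted_sum[OF prob_space_axioms p S _ op_norm_nonneg K0])
      show "s * (\<Sum>n\<in>{n \<in> S. s \<le> op_norm (\<sigma> n)}. (real (n + 1))\<^sup>2) \<le> enn2real (K_const \<sigma>)" if "0 < s" for s
        by (rule K_const_level_bound[OF K S that])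
      show "0 \<le> F g n" for g n
        by (simp add: F_def hs0)
      show "F h n \<le> (\<integral>u. cmod (h u) \<partial>\<mu>)" if "integrable \<mu> h" for h n
        using fourier_coeff_L1_bound[OF \<mu> t that, of n] by (simp add: F_def divide_le_eq mult.commute)
      show "F (\<lambda>u. g u + h u) n \<le> F g n + F h n" if "integrable \<mu> g" "integrable \<mu> h" for g h n
        using fourier_coeff_triangle[OF \<mu> t that, of n]
        by (simp add: F_def add_divide_distrib[symmetric] divide_right_mono)
      show "(\<Sum>n\<in>S. (real (n + 1))\<^sup>2 * (F g n)\<^sup>2) \<le> (\<integral>u. (cmod (g u))\<^sup>2 \<partial>\<mu>)"
        if g: "g \<in> borel_measurable \<mu>" and B: "\<And>u. cmod (g u) \<le> B" for g B
      proof -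
        have "integrable \<mu> (\<lambda>u. (cmod (g u))\<^sup>2)"
          using g power_mono[OF B norm_ge_zero, of _ 2]
          by (intro integrable_const_bound[of _ "B\<^sup>2"]) auto
        from fourier_coeff_bessel[OF \<mu> t S g this]
        have "(\<Sum>n\<in>S. real (n + 1) * (hs_norm (fourier_coeff \<mu> t g n))\<^sup>2) \<le> (\<integral>u. (cmod (g u))\<^sup>2 \<partial>\<mu>)" .
        moreover have "(real (n + 1))\<^sup>2 * (F g n)\<^sup>2 = real (n + 1) * (hs_norm (fourier_coeff \<mu> t g n))\<^sup>2" for n
          by (simp add: F_def power_divide power2_eq_square del: of_nat_add of_nat_Suc)
        ultimately show ?thesis
          by simp
      qed
    qed (use f in \<open>auto simp: in_Lp_def\<close>)
    then show ?thesis
      unfolding sum_eq using p by (simp add: pow0_def Lp_norm_powr)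
  qed
qed

end

theorem theorem2p4:
  fixes p :: real
  assumes "1 < p" and "p \<le> 2"
  shows "\<exists>C > 0. \<forall>(\<mu> :: (complex^2^2) measure) (t :: nat \<Rightarrow> complex^2^2 \<Rightarrow> complex mat)
            (\<sigma> :: nat \<Rightarrow> complex mat).
    normalized_haar_SU2 \<mu> \<longrightarrow>
    (\<forall>n. SU2_unitary_rep n (t n)) \<longrightarrow>
    (\<forall>n. \<sigma> n \<in> carrier_mat (n + 1) (n + 1)) \<longrightarrow>
    K_const \<sigma> < \<infinity> \<longrightarrow>
    (\<forall>f. in_Lp \<mu> p f \<longrightarrow>
      (\<Sum>\<^sub>\<infinity>n. ennreal (real (n + 1) powr (p * (2 / p - 1 / 2))
                    * hs_norm (fourier_coeff \<mu> t f n) powr p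
                    * pow0 (op_norm (\<sigma> n)) (2 - p)))
        \<le> ennreal (C * pow0 (enn2real (K_const \<sigma>)) (2 - p) * Lp_norm \<mu> p f powr p))"
proof (intro exI conjI allI impI)
  \<comment> \<open>The interpolation constant tends to infinity as p tends to 2, so the endpoint
    receives the constant 1 of Bessel's inequality.\<close>
  let ?C = "if p = 2 then 1 else 4 * p / (2 - p) + 4 * p / (p - 1)"
  show "0 < ?C"
    using assms by (auto intro!: add_pos_pos divide_pos_pos)
  fix \<mu> :: "(complex^2^2) measure" and t :: "nat \<Rightarrow> complex^2^2 \<Rightarrow> complex mat"
    and \<sigma> :: "nat \<Rightarrow> complex mat" and f :: "complex^2^2 \<Rightarrow> complex"
  assume \<mu>: "normalized_haar_SU2 \<mu>" and t: "\<forall>n. SU2_unitary_rep n (t n)"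
    and K: "K_const \<sigma> < \<infinity>" and f: "in_Lp \<mu> p f"
  show "(\<Sum>\<^sub>\<infinity>n. ennreal (real (n + 1) powr (p * (2 / p - 1 / 2)) * hs_norm (fourier_coeff \<mu> t f n) powr p
      * pow0 (op_norm (\<sigma> n)) (2 - p)))
    \<le> ennreal (?C * pow0 (enn2real (K_const \<sigma>)) (2 - p) * Lp_norm \<mu> p f powr p)"
  proof (rule infsum_ennreal_le)
    show "0 \<le> real (n + 1) powr (p * (2 / p - 1 / 2)) * hs_norm (fourier_coeff \<mu> t f n) powr p
      * pow0 (op_norm (\<sigma> n)) (2 - p)" for n
      by (simp add: pow0_def)
    show "(\<Sum>n\<in>S. real (n + 1) powr (p * (2 / p - 1 / 2)) * hs_norm (fourier_coeff \<mu> t f n) powr p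
        * pow0 (op_norm (\<sigma> n)) (2 - p))
      \<le> ?C * pow0 (enn2real (K_const \<sigma>)) (2 - p) * Lp_norm \<mu> p f powr p" if "finite S" for S
      using paley_L2[OF \<mu> _ f _ that] paley_interpolated[OF \<mu> _ f _ _ K that] t assms by (cases "p = 2") auto
  qed
qed

end
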